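(* There is an absolute constant $c>0$ such that for all positive integers $n,k,d$ there is an input sequence $X\in[0,1]^n$ with pairwise distinct entries whose twin-width is $d$ and such that $\mathrm{OPT}_k(X)\ge c\cdot d^{-2}k^{-3}\cdot n^{1/(\lfloor \log_{2d}k\rfloor+1)}$.
   Context: A sequence $X=(x_1,\dots,x_n)$ with pairwise distinct entries is identified with the point set $\{(i/n,x_i): i\in[n]\}$; its twin-width is the twin-width of this point set. Twin-width: a rectangle family is a set of axis-parallel rectangles (points count as degenerate rectangles). Merging two rectangles replaces them by their bounding box. A merge sequence of an $n$-point set $P$ is a sequence of rectangle families $\mathscr{R}_1=P,\dots,\mathscr{R}_n$ with $\mathscr{R}_n$ a single rectangle and each $\mathscr{R}_{i+1}$ obtained from $\mathscr{R}_i$ by merging two of its rectangles. Two rectangles are homogeneous if both their $x$-projections and their $y$-projections are disjoint. The red graph of $\mathscr{R}_i$ joins every two distinct non-homogeneous rectangles of $\mathscr{R}_i$. A merge sequence is $d$-wide if all its red graphs have maximum degree $<d$; the twin-width of $P$ is the least $d$ for which a $d$-wide merge sequence exists. $k$-server on the line: for requests $X\in[0,1]^n$ and $k$ servers, let $p_i^j\in[0,1]$ be the position of server $j$ after request $i$, with $p_0^j=0$. A solution is valid if for every $i$ some $p_i^j=x_i$; its cost is $\sum_{i}\sum_{j}|p_i^j-p_{i-1}^j|$; $\mathrm{OPT}_k(X)$ is the minimum cost.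
   Formalization: Twin-width exactly d is asserted whenever some input of length n with distinct entries has twin-width d; otherwise only twin-width at most d is asserted (for n = 1, d = 2 no input has twin-width d, so the literal claim fails there). *)

theory Defs
  imports Complex_Main
begin

section \<open>Twin-width of point sets\<close>

type_synonym region = "(real \<times> real) set"

definition axis_rectangle :: "region \<Rightarrow> bool" where
  "axis_rectangle A \<longleftrightarrow> (\<exists>a b c d. a \<le> b \<and> c \<le> d \<and> A = {a..b} \<times> {c..d})"

definition bounding_box :: "region \<Rightarrow> region" where
  "bounding_box S = axis_rectangle hull S"

definition homogeneous :: "region \<Rightarrow> region \<Rightarrow> bool" where
  "homogeneous A B \<longleftrightarrow> fst ` A \<inter> fst ` B = {} \<and> snd ` A \<inter> snd ` B = {}"

definition red_degree :: "region set \<Rightarrow> region \<Rightarrow> nat" where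
  "red_degree F A = card {B \<in> F. B \<noteq> A \<and> \<not> homogeneous A B}"

definition merges_to :: "region set \<Rightarrow> region set \<Rightarrow> bool" where
  "merges_to F G \<longleftrightarrow>
     (\<exists>A\<in>F. \<exists>B\<in>F. A \<noteq> B \<and> G = insert (bounding_box (A \<union> B)) (F - {A, B}))"

text \<open>The families are \<open>R 1, \<dots>, R (card P)\<close>; other values of \<open>R\<close> are irrelevant. If no two
  points of \<open>P\<close> share a coordinate, a newly created bounding box never coincides with another
  rectangle of the family, so representing families as sets loses nothing.\<close>

definition merge_sequence :: "(real \<times> real) set \<Rightarrow> (nat \<Rightarrow> region set) \<Rightarrow> bool" where
  "merge_sequence P R \<longleftrightarrow>
     R 1 = (\<lambda>p. {p}) ` P \<and>
     (\<forall>i\<in>{1..<card P}. merges_to (R i) (R (Suc i))) \<and>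
     is_singleton (R (card P))"

definition wide :: "nat \<Rightarrow> (real \<times> real) set \<Rightarrow> (nat \<Rightarrow> region set) \<Rightarrow> bool" where
  "wide d P R \<longleftrightarrow> (\<forall>i\<in>{1..card P}. \<forall>A\<in>R i. red_degree (R i) A < d)"

definition twin_width :: "(real \<times> real) set \<Rightarrow> nat" where
  "twin_width P = (LEAST d. \<exists>R. merge_sequence P R \<and> wide d P R)"

text \<open>Lists are indexed from 0, so the request \<open>x\<^sub>i\<close> is \<open>X ! (i - 1)\<close>, here and below.\<close>

definition seq_points :: "real list \<Rightarrow> (real \<times> real) set" where
  "seq_points X = (\<lambda>i. (real i / real (length X), X ! (i - 1))) ` {1..length X}"

definition seq_twin_width :: "real list \<Rightarrow> nat" where
  "seq_twin_width X = twin_width (seq_points X)"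


section \<open>The \<open>k\<close>-server problem on the line\<close>

text \<open>\<open>p i j\<close> is the position of server \<open>j \<in> {1..k}\<close> after request \<open>i\<close>.\<close>

definition valid_solution :: "nat \<Rightarrow> real list \<Rightarrow> (nat \<Rightarrow> nat \<Rightarrow> real) \<Rightarrow> bool" where
  "valid_solution k X p \<longleftrightarrow>
     (\<forall>j\<in>{1..k}. p 0 j = 0) \<and>
     (\<forall>i\<in>{1..length X}. \<forall>j\<in>{1..k}. p i j \<in> {0..1}) \<and>
     (\<forall>i\<in>{1..length X}. \<exists>j\<in>{1..k}. p i j = X ! (i - 1))"

definition solution_cost :: "nat \<Rightarrow> real list \<Rightarrow> (nat \<Rightarrow> nat \<Rightarrow> real) \<Rightarrow> real" where
  "solution_cost k X p = (\<Sum>i=1..length X. \<Sum>j=1..k. \<bar>p i j - p (i - 1) j\<bar>)"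

text \<open>For \<open>k \<ge> 1\<close> and requests in \<open>[0,1]\<close> the infimum is a minimum: the valid solutions form a
  nonempty compact set on which the cost is continuous.\<close>

definition OPT :: "nat \<Rightarrow> real list \<Rightarrow> real" where
  "OPT k X = Inf {solution_cost k X p | p. valid_solution k X p}"

definition distinct_inputs :: "nat \<Rightarrow> real list set" where
  "distinct_inputs n = {X. length X = n \<and> distinct X \<and> set X \<subseteq> {0..1}}"

end

theory Submission
  imports Defs "HOL-Library.Disjoint_Sets" "HOL-Library.Multiset"
begin

text \<open>Put \<open>D = 2 * d\<close> and let \<open>h\<close> be the integer with \<open>D ^ h \<le> k < D ^ (h + 1)\<close>. The hard input of
  level \<open>h + 1\<close> visits \<open>D\<close> separated rows cyclically for \<open>T\<close> rounds, each visit being a copy of the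
  level-\<open>h\<close> input scaled by \<open>1 / (2 * D * T)\<close>; level \<open>0\<close> is a single request. In every round either
  a server changes rows, or some row is served by fewer than \<open>D ^ h\<close> servers, so by induction
  \<open>k\<close> servers pay at least \<open>T / (2 * D) ^ (h + 1)\<close> for about \<open>(D * T) ^ (h + 1)\<close> requests. Pairing
  the rows into \<open>d\<close> converging spirals and merging from right to left keeps the twin-width at most \<open>d\<close>.

  To reach twin-width exactly \<open>d\<close>, append \<open>(d + 1)\<^sup>2\<close> requests at the end. Swapping two consecutive
  entries changes at most one red edge, hence the twin-width by at most one. Increasing requests keep
  twin-width \<open>d\<close>, whereas a transposed grid forces at least \<open>d\<close>, so some order in between has
  twin-width \<open>d\<close>. If \<open>n < 8 * d\<^sup>2\<close>, the bound is at most \<open>1 / 8\<close> and any input in \<open>[1/2, 1]\<close> does.\<close>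

section \<open>Merge sequences of set partitions\<close>

text \<open>The bounding boxes of two finite non-empty parts have disjoint projections to a
  coordinate exactly if the parts are separated in it. This lets sets of indices stand for
  rectangles.\<close>

definition separated :: "('i \<Rightarrow> 'x::linorder) \<Rightarrow> 'i set \<Rightarrow> 'i set \<Rightarrow> bool" where
  "separated u A B \<longleftrightarrow> (\<forall>a\<in>A. \<forall>b\<in>B. u a < u b) \<or> (\<forall>a\<in>A. \<forall>b\<in>B. u b < u a)"

definition homog :: "('i \<Rightarrow> 'x::linorder) \<Rightarrow> ('i \<Rightarrow> 'y::linorder) \<Rightarrow> 'i set \<Rightarrow> 'i set \<Rightarrow> bool" where
  "homog u v A B \<longleftrightarrow> separated u A B \<and> separated v A B"

definition narrow :: "('i set \<Rightarrow> 'i set \<Rightarrow> bool) \<Rightarrow> nat \<Rightarrow> 'i set set \<Rightarrow> bool" where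
  "narrow H d F \<longleftrightarrow> (\<forall>A\<in>F. card {B \<in> F. B \<noteq> A \<and> \<not> H A B} < d)"

text \<open>A \<open>d\<close>-wide merge sequence built up from its last family and started at an
  arbitrary one. Parts are merged by plain union. The empty family is not collapsible.\<close>

inductive collapsible :: "('i set \<Rightarrow> 'i set \<Rightarrow> bool) \<Rightarrow> nat \<Rightarrow> 'i set set \<Rightarrow> bool"
  for H :: "'i set \<Rightarrow> 'i set \<Rightarrow> bool" and d :: nat where
  single: "narrow H d {A} \<Longrightarrow> collapsible H d {A}"
| merge: "narrow H d F \<Longrightarrow> A \<in> F \<Longrightarrow> B \<in> F \<Longrightarrow> A \<noteq> B \<Longrightarrow>
    collapsible H d (insert (A \<union> B) (F - {A, B})) \<Longrightarrow> collapsible H d F"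

abbreviation singletons :: "'i set \<Rightarrow> 'i set set" where
  "singletons I \<equiv> (\<lambda>i. {i}) ` I"

section \<open>Elementary properties of collapsible families and of merging\<close>

lemma collapsible_narrow: "collapsible H d F \<Longrightarrow> narrow H d F"
  by (cases rule: collapsible.cases) auto

lemma collapsible_finite: "collapsible H d F \<Longrightarrow> finite F"
  by (induction rule: collapsible.induct) auto

lemma separated_commute: "separated u A B \<longleftrightarrow> separated u B A"
  unfolding separated_def by blast

lemma separated_mono: "separated u A B \<Longrightarrow> A' \<subseteq> A \<Longrightarrow> B' \<subseteq> B \<Longrightarrow> separated u A' B'"
  unfolding separated_def by blast

lemma homog_commute: "homog u v A B \<longleftrightarrow> homog u v B A"
  unfolding homog_def by (simp add: separated_commute)

lemma homog_mono: "homog u v A B \<Longrightarrow> A' \<subseteq> A \<Longrightarrow> B' \<subseteq> B \<Longrightarrow> homog u v A' B'"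
  unfolding homog_def by (blast intro: separated_mono)

lemma homog_not_subset: "homog u v A B \<Longrightarrow> A \<noteq> {} \<Longrightarrow> \<not> A \<subseteq> B"
  unfolding homog_def separated_def by fastforce

lemma partition_on_merge:
  assumes "partition_on I F" "A \<in> F" "B \<in> F" "A \<noteq> B"
  shows "partition_on I (insert (A \<union> B) (F - {A, B}))"
proof -
  have "C \<inter> (A \<union> B) = {}" if "C \<in> F - {A, B}" for C
    using assms that unfolding partition_on_def disjoint_def by (simp add: Int_Un_distrib)
  moreover have "disjoint (F - {A, B})"
    using assms unfolding partition_on_def disjoint_def by simp
  ultimately have "disjoint (insert (A \<union> B) (F - {A, B}))"
    by (auto simp add: pairwise_insert disjnt_def Int_commute)
  then show ?thesis
    using assms unfolding partition_on_def by auto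
qed

lemma partition_on_merge_card:
  assumes "partition_on I F" "finite I" "A \<in> F" "B \<in> F" "A \<noteq> B"
  shows "card F = Suc (card (insert (A \<union> B) (F - {A, B})))"
proof -
  have fin: "finite F"
    using assms finite_elements by blast
  have "A \<union> B \<notin> F - {A, B}"
  proof
    assume *: "A \<union> B \<in> F - {A, B}"
    then have "(A \<union> B) \<inter> A = {}"
      using assms(1,3) partition_onD2[THEN disjointD, of I F "A \<union> B" A] by blast
    then show False using partition_onD3[OF assms(1)] assms(3) by auto
  qed
  moreover have "card (F - {A, B}) = card F - 2"
    using assms fin by (simp add: card_Diff_subset)
  moreover have "card F \<ge> 2"
    using assms fin card_mono[of F "{A, B}"] by simp
  ultimately show ?thesis using fin by simp
qed

lemma partition_on_singletons: "partition_on I (singletons I)"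
  unfolding partition_on_def disjoint_def by auto

text \<open>The parts of \<open>F\<close> are merged first while \<open>K\<close> waits. They are
  homogeneous to every part of \<open>K\<close> because their union is. Hence red edges stay inside
  \<open>F\<close> or inside \<open>K\<close>, and those inside \<open>K\<close> are already counted
  in the family where \<open>F\<close> has become one part.\<close>

lemma collapsible_in_context:
  assumes "collapsible H d F" "H = homog u v"
    and "\<And>C. C \<in> K \<Longrightarrow> H C (\<Union>F)" "{} \<notin> F" "finite K"
    and "collapsible H d (insert (\<Union>F) K)"
  shows "collapsible H d (F \<union> K)"
  using assms
proof (induction rule: collapsible.induct)
  case (single A)
  then show ?case by simp
next
  case (merge F A B)
  have sub: "H C A'" "H A' C" if "C \<in> K" "A' \<in> F" for C A'
    using merge.prems(1) that homog_mono[of u v C "\<Union>F" C A'] homog_commute[of u v C A'] merge.prems(2)[of C]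
    by (simp_all add: Sup_upper)
  have disj: "A' \<notin> K" if "A' \<in> F" for A'
    using sub(1)[of A' A'] that merge.prems(1,3) homog_not_subset[of u v A' A'] by auto
  have U: "\<Union>(insert (A \<union> B) (F - {A, B})) = \<Union>F"
    using merge.hyps by auto
  have narrow: "narrow H d (F \<union> K)"
    unfolding narrow_def
  proof
    fix C assume "C \<in> F \<union> K"
    then consider "C \<in> F" | "C \<in> K" by blast
    then show "card {B \<in> F \<union> K. B \<noteq> C \<and> \<not> H C B} < d"
    proof cases
      case 1
      then have "{B \<in> F \<union> K. B \<noteq> C \<and> \<not> H C B} = {B \<in> F. B \<noteq> C \<and> \<not> H C B}"
        using sub by blast
      then show ?thesis using merge.hyps(1) 1 unfolding narrow_def by simp
    next
      case 2
      have "{B \<in> F \<union> K. B \<noteq> C \<and> \<not> H C B} \<subseteq> {B \<in> insert (\<Union>F) K. B \<noteq> C \<and> \<not> H C B}"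
        using sub 2 by blast
      then have "card {B \<in> F \<union> K. B \<noteq> C \<and> \<not> H C B} \<le> card {B \<in> insert (\<Union>F) K. B \<noteq> C \<and> \<not> H C B}"
        using merge.prems(4) by (intro card_mono) auto
      also have "\<dots> < d"
        using collapsible_narrow[OF merge.prems(5)] 2 unfolding narrow_def by blast
      finally show ?thesis .
    qed
  qed
  have eq: "insert (A \<union> B) (F \<union> K - {A, B}) = insert (A \<union> B) (F - {A, B}) \<union> K"
    using disj merge.hyps by blast
  have "collapsible H d (insert (A \<union> B) (F - {A, B}) \<union> K)"
    using merge.prems merge.hyps(2) by (intro merge.IH; (unfold U)?) auto
  then show ?case
    using narrow merge.hyps eq by (intro collapsible.merge[of H d "F \<union> K" A B]) auto
qed

lemma collapsible_image:
  assumes "collapsible H d F" "\<And>A. A \<in> F \<Longrightarrow> A \<subseteq> I" "inj_on f I"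
    and "\<And>A B. A \<subseteq> I \<Longrightarrow> B \<subseteq> I \<Longrightarrow> H A B \<Longrightarrow> H' (f ` A) (f ` B)"
  shows "collapsible H' d ((`) f ` F)"
  using assms(1,2)
proof (induction rule: collapsible.induct)
  case (single A)
  then have "d > 0" by (auto simp: narrow_def)
  then have "narrow H' d {f ` A}" by (simp add: narrow_def cong: conj_cong)
  then show ?case by (auto intro: collapsible.single)
next
  case (merge F A B)
  have fin: "finite F"
    using collapsible_finite[OF merge.hyps(5)] by auto
  have inj: "inj_on ((`) f) F"
  proof (rule inj_onI)
    fix A B assume "A \<in> F" "B \<in> F" "f ` A = f ` B"
    then show "A = B"
      using merge.prems[of A] merge.prems[of B] inj_on_image_eq_iff[OF assms(3)] by blast
  qed
  have narrow: "narrow H' d ((`) f ` F)"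
    unfolding narrow_def
  proof
    fix C' assume "C' \<in> (`) f ` F"
    then obtain C where C: "C \<in> F" "C' = f ` C" by blast
    have "{B \<in> (`) f ` F. B \<noteq> C' \<and> \<not> H' C' B} \<subseteq> (`) f ` {B \<in> F. B \<noteq> C \<and> \<not> H C B}"
      using C assms(4) merge.prems by auto
    then have "card {B \<in> (`) f ` F. B \<noteq> C' \<and> \<not> H' C' B} \<le> card {B \<in> F. B \<noteq> C \<and> \<not> H C B}"
      using fin by (intro surj_card_le) auto
    also have "\<dots> < d" using C merge.hyps(1) unfolding narrow_def by blast
    finally show "card {B \<in> (`) f ` F. B \<noteq> C' \<and> \<not> H' C' B} < d" .
  qed
  have "collapsible H' d ((`) f ` insert (A \<union> B) (F - {A, B}))"
    using merge.prems merge.hyps(2,3) by (intro merge.IH) auto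
  also have "(`) f ` insert (A \<union> B) (F - {A, B}) = insert (f ` A \<union> f ` B) ((`) f ` F - {f ` A, f ` B})"
    using inj_on_image_set_diff[OF inj, of F "{A, B}"] merge.hyps(2,3) by (simp add: image_Un)
  finally have "collapsible H' d (insert (f ` A \<union> f ` B) ((`) f ` F - {f ` A, f ` B}))" .
  moreover have "f ` A \<noteq> f ` B" using inj merge.hyps(2-4) by (meson inj_onD)
  ultimately show ?case
    using narrow merge.hyps(2,3) by (intro collapsible.merge[of H' d "(`) f ` F" "f ` A" "f ` B"]) simp_all
qed

text \<open>Separation consists of strict inequalities, so a map that preserves these keeps
  homogeneous pairs homogeneous. This transports merge sequences to scaled copies, shifted index
  ranges and reindexed lists.\<close>

lemma collapsible_singletons_image:
  assumes "collapsible (homog u v) d (singletons I)" "inj_on f I"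
    and "\<And>i j. i \<in> I \<Longrightarrow> j \<in> I \<Longrightarrow> u i < u j \<Longrightarrow> u' (f i) < u' (f j)"
    and "\<And>i j. i \<in> I \<Longrightarrow> j \<in> I \<Longrightarrow> v i < v j \<Longrightarrow> v' (f i) < v' (f j)"
  shows "collapsible (homog u' v') d (singletons (f ` I))"
proof -
  have "separated u' (f ` A) (f ` B)" if "A \<subseteq> I" "B \<subseteq> I" "separated u A B" for A B
    using that assms(3) unfolding separated_def by (simp add: subset_iff) blast
  moreover have "separated v' (f ` A) (f ` B)" if "A \<subseteq> I" "B \<subseteq> I" "separated v A B" for A B
    using that assms(4) unfolding separated_def by (simp add: subset_iff) blast
  ultimately have "collapsible (homog u' v') d ((`) f ` singletons I)"
    using assms(1,2) by (intro collapsible_image[where H = "homog u v" and I = I]) (auto simp: homog_def)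
  also have "(`) f ` singletons I = singletons (f ` I)"
    by (auto simp: image_image)
  finally show ?thesis .
qed

text \<open>Any order of merges works, because every part has fewer than \<open>d\<close> others
  besides it.\<close>

lemma collapsible_card_le:
  assumes "finite F" "F \<noteq> {}" "card F \<le> d"
  shows "collapsible H d F"
  using assms
proof (induction "card F" arbitrary: F rule: less_induct)
  case less
  have narrow: "narrow H d F"
    unfolding narrow_def
  proof
    fix A assume "A \<in> F"
    then have "{B \<in> F. B \<noteq> A \<and> \<not> H A B} \<subset> F" by blast
    then have "card {B \<in> F. B \<noteq> A \<and> \<not> H A B} < card F"
      using less.prems(1) psubset_card_mono by blast
    then show "card {B \<in> F. B \<noteq> A \<and> \<not> H A B} < d" using less.prems by linarith
  qed
  show ?case
  proof (cases "\<exists>A\<in>F. \<exists>B\<in>F. A \<noteq> B")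
    case True
    then obtain A B where AB: "A \<in> F" "B \<in> F" "A \<noteq> B" by blast
    have "card (F - {A, B}) = card F - 2"
      using AB less.prems(1) by (simp add: card_Diff_subset)
    moreover have "card F \<ge> 2"
      using AB less.prems(1) card_mono[of F "{A, B}"] by simp
    ultimately have "card (insert (A \<union> B) (F - {A, B})) < card F"
      using less.prems(1) card_insert_le_m1[of "card F - 1" "F - {A, B}" "A \<union> B"] by linarith
    then have "collapsible H d (insert (A \<union> B) (F - {A, B}))"
      using less.prems by (intro less.hyps) auto
    then show ?thesis using narrow AB by (intro collapsible.merge[of H d F A B])
  next
    case False
    then obtain A where "F = {A}" using less.prems(2) by blast
    then show ?thesis using narrow collapsible.single by blast
  qed
qed

text \<open>A part of \<open>S\<close> has no red edge, and a part of \<open>M\<close> has red edges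
  only to the other parts of \<open>M\<close>, of which there are fewer than
  \<open>d\<close>.\<close>

lemma narrow_few:
  assumes "finite M" "card M \<le> d" "d > 0"
    and "\<And>A B. A \<in> S \<Longrightarrow> B \<in> M \<union> S \<Longrightarrow> A \<noteq> B \<Longrightarrow> H A B \<and> H B A"
  shows "narrow H d (M \<union> S)"
  unfolding narrow_def
proof
  fix A assume A: "A \<in> M \<union> S"
  show "card {B \<in> M \<union> S. B \<noteq> A \<and> \<not> H A B} < d"
  proof (cases "A \<in> S")
    case True
    then have "{B \<in> M \<union> S. B \<noteq> A \<and> \<not> H A B} = {}" using assms(4) by blast
    then show ?thesis using assms(3) by (simp only: card.empty)
  next
    case False
    then have "{B \<in> M \<union> S. B \<noteq> A \<and> \<not> H A B} \<subset> M" using assms(4) A by blast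
    from psubset_card_mono[OF assms(1) this] show ?thesis using assms(2) by linarith
  qed
qed

text \<open>Blocks are processed from right to left. The processed ones form at most
  \<open>d\<close> parts, one per colour; the others are still single points. The next block is
  collapsed to one part, which is homogeneous to all the rest by the hypotheses on \<open>u\<close>
  and \<open>v\<close>, and is then absorbed by the part of its colour. So red edges occur only
  inside the block in work or among the coloured parts.\<close>

lemma collapsible_blocks:
  fixes u :: "'i \<Rightarrow> 'x::linorder" and v :: "'i \<Rightarrow> 'y::linorder" and N :: nat
  assumes "N > 0" "d > 0"
    and fin: "\<And>s. s < N \<Longrightarrow> finite (B s)" and ne: "\<And>s. s < N \<Longrightarrow> B s \<noteq> {}"
    and blocks: "\<And>s. s < N \<Longrightarrow> collapsible (homog u v) d (singletons (B s))"
    and col: "\<And>s. s < N \<Longrightarrow> col s < d"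
    and inj: "inj_on u (\<Union>s<N. B s)" "inj_on v (\<Union>s<N. B s)"
    and u: "\<And>s s' i j. s < s' \<Longrightarrow> s' < N \<Longrightarrow> i \<in> B s \<Longrightarrow> j \<in> B s' \<Longrightarrow> u i < u j"
    and v: "\<And>s c. s < N \<Longrightarrow> c < d \<Longrightarrow> separated v (B s) (\<Union>(B ` {s'. s < s' \<and> s' < N \<and> col s' = c}))"
  shows "collapsible (homog u v) d (singletons (\<Union>s<N. B s))"
proof -
  define A where "A s c = \<Union>(B ` {s'. s \<le> s' \<and> s' < N \<and> col s' = c})" for s c
  define M where "M s = A s ` {..<d} - {{}}" for s
  define S where "S s = singletons (\<Union>s'<s. B s')" for s
  let ?H = "homog u v"
  have finM: "finite (M s)" for s unfolding M_def by simp
  have cardM: "card (M s) \<le> d" for s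
  proof -
    have "card (M s) \<le> card (A s ` {..<d})" unfolding M_def by (intro card_mono) auto
    also have "\<dots> \<le> d" using card_image_le[of "{..<d}" "A s"] by simp
    finally show ?thesis .
  qed
  have sepA: "?H (B s) (A s' c)" if "s < s'" "s < N" "c < d" for s s' c
  proof -
    have "u i < u j" if ij: "i \<in> B s" "j \<in> A s' c" for i j
    proof -
      obtain x where "s' \<le> x" "x < N" "j \<in> B x" using ij(2) unfolding A_def by blast
      then show ?thesis using u[of s x i j] ij(1) \<open>s < s'\<close> by simp
    qed
    then have "separated u (B s) (A s' c)"
      unfolding separated_def by blast
    moreover have "A s' c \<subseteq> \<Union>(B ` {s'. s < s' \<and> s' < N \<and> col s' = c})"
      unfolding A_def using that(1) by (intro Union_mono image_mono) auto
    then have "separated v (B s) (A s' c)"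
      by (rule separated_mono[OF v[OF that(2,3)] order.refl])
    ultimately show ?thesis by (simp add: homog_def)
  qed
  have sepB: "?H (B s) (B s')" if "s < s'" "s' < N" for s s'
    by (rule homog_mono[OF sepA[of s s' "col s'"]]) (use that col in \<open>auto simp: A_def\<close>)
  have sepS: "?H {i} {j}" if "i \<in> (\<Union>s<N. B s)" "j \<in> (\<Union>s<N. B s)" "i \<noteq> j" for i j
    using that inj unfolding homog_def separated_def inj_on_def by (metis linorder_neq_iff singletonD)
  \<comment> \<open>This is the state in which the blocks from \<open>s\<close> on are processed.
    The induction runs backwards in time: \<open>s = 0\<close> is a late stage with at most
    \<open>d\<close> parts, \<open>s = N\<close> the start with single points only.\<close>
  have "collapsible ?H d (M s \<union> S s)" if "s \<le> N" for s
    using that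
  proof (induction s)
    case 0
    have "A 0 (col 0) \<noteq> {}" using ne[of 0] assms(1) unfolding A_def by auto
    then have "M 0 \<noteq> {}" using col[of 0] assms(1) unfolding M_def by auto
    moreover have "S 0 = {}" unfolding S_def by simp
    ultimately show ?case using collapsible_card_le[OF finM _ cardM] by simp
  next
    case (Suc s)
    then have s: "s < N" by simp
    let ?A' = "A (Suc s) (col s)"
    define K where "K = M (Suc s) \<union> S s"
    have finS: "finite (S s)" unfolding S_def using fin s by simp
    have disjA: "A (Suc s) c \<inter> A (Suc s) c' = {}" if "c \<noteq> c'" for c c'
    proof -
      have "B x \<inter> B y = {}" if "x < N" "y < N" "x \<noteq> y" for x y
        using that u[of x y] u[of y x] by (metis disjoint_iff less_irrefl linorder_neqE_nat)
      then show ?thesis using that unfolding A_def by blast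
    qed
    have sep_BK: "?H C (B s)" if "C \<in> K" for C
    proof -
      from that consider c where "c < d" "C = A (Suc s) c" | i s' where "i \<in> B s'" "s' < s" "C = {i}"
        unfolding K_def M_def S_def by auto
      then show ?thesis
      proof cases
        case 1
        then show ?thesis using sepA[of s "Suc s" c] s by (simp add: homog_commute)
      next
        case 2
        then show ?thesis using homog_mono[OF sepB[of s' s]] s by blast
      qed
    qed
    have sep_SM: "?H C C'" if CC': "C \<in> S s" "C' \<in> M (Suc s)" for C C'
    proof -
      obtain i s' c where "C = {i}" "i \<in> B s'" "s' < s" "C' = A (Suc s) c" "c < d"
        using CC' unfolding S_def M_def by blast
      then show ?thesis using homog_mono[OF sepA[of s' "Suc s" c]] s by simp
    qed
    have sep_SS: "?H C C'" if CC': "C \<in> S s" "C' \<in> S s" "C \<noteq> C'" for C C'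
    proof -
      obtain i j where ij: "C = {i}" "C' = {j}" "i \<in> (\<Union>s'<s. B s')" "j \<in> (\<Union>s'<s. B s')" "i \<noteq> j"
        using CC' unfolding S_def by blast
      moreover have "(\<Union>s'<s. B s') \<subseteq> (\<Union>s<N. B s)" using s by force
      ultimately show ?thesis using sepS[of i j] by (simp add: subset_iff)
    qed
    have narrow: "narrow ?H d (insert (B s) K)"
    proof -
      have "narrow ?H d (M (Suc s) \<union> insert (B s) (S s))"
      proof (rule narrow_few[OF finM cardM assms(2)])
        fix C C' assume *: "C \<in> insert (B s) (S s)" "C' \<in> M (Suc s) \<union> insert (B s) (S s)" "C \<noteq> C'"
        then have "?H C C'"
          using sep_BK[of C] sep_BK[of C'] sep_SM[of C C'] sep_SS[of C C'] homog_commute[of u v "B s" C']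
          unfolding K_def by blast
        then show "?H C C' \<and> ?H C' C" using homog_commute[of u v C C'] by simp
      qed
      then show ?thesis unfolding K_def by simp
    qed
    have "{s'. s \<le> s' \<and> s' < N \<and> col s' = col s} = insert s {s'. Suc s \<le> s' \<and> s' < N \<and> col s' = col s}"
      using s by (auto simp: Suc_le_eq le_less)
    then have A_col: "A s (col s) = B s \<union> ?A'"
      unfolding A_def by simp
    have A_other: "A s c = A (Suc s) c" if "c \<noteq> col s" for c
    proof -
      have "{s'. s \<le> s' \<and> s' < N \<and> col s' = c} = {s'. Suc s \<le> s' \<and> s' < N \<and> col s' = c}"
        using that by (auto simp: Suc_le_eq le_less)
      then show ?thesis unfolding A_def by simp
    qed
    have M_s: "M s = insert (B s \<union> ?A') (M (Suc s) - {?A'})"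
    proof
      show "M s \<subseteq> insert (B s \<union> ?A') (M (Suc s) - {?A'})"
      proof
        fix C assume "C \<in> M s"
        then obtain c where c: "c < d" "C = A s c" "C \<noteq> {}" unfolding M_def by auto
        show "C \<in> insert (B s \<union> ?A') (M (Suc s) - {?A'})"
        proof (cases "c = col s")
          case False
          then have "C = A (Suc s) c" using A_other c by simp
          moreover have "C \<noteq> ?A'" using disjA[OF False] c(3) calculation by auto
          ultimately show ?thesis using c unfolding M_def by auto
        qed (use c A_col in simp)
      qed
      show "insert (B s \<union> ?A') (M (Suc s) - {?A'}) \<subseteq> M s"
      proof
        fix C assume "C \<in> insert (B s \<union> ?A') (M (Suc s) - {?A'})"
        then consider "C = A s (col s)" | c where "c < d" "C = A (Suc s) c" "C \<noteq> {}" "c \<noteq> col s"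
          using A_col unfolding M_def by auto
        then show "C \<in> M s"
        proof cases
          case 1
          then show ?thesis using col[OF s] ne[OF s] A_col unfolding M_def by auto
        next
          case 2
          then show ?thesis using A_other[of c] unfolding M_def by blast
        qed
      qed
    qed
    \<comment> \<open>A non-empty part is not homogeneous to itself, but \<open>B s\<close> is
      homogeneous to every part of \<open>K\<close>.\<close>
    have notin: "B s \<notin> K" using sep_BK[of "B s"] homog_not_subset[of u v "B s" "B s"] ne[OF s] by auto
    have A'_notin: "?A' \<notin> S s"
    proof
      assume "?A' \<in> S s"
      then obtain i s' where "?A' = {i}" "i \<in> B s'" "s' < s" unfolding S_def by auto
      then show False
        using sepA[of s' "Suc s" "col s"] s col homog_mono[of u v "B s'" ?A' "{i}" "{i}"]
          homog_not_subset[of u v "{i}" "{i}"] by simp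
    qed
    have IH: "collapsible ?H d (M s \<union> S s)" using Suc by simp
    \<comment> \<open>If no later block has the colour of \<open>s\<close>, block \<open>s\<close>
      itself becomes the part of that colour and no merge takes place.\<close>
    have "collapsible ?H d (insert (B s) K)"
    proof (cases "?A' = {}")
      case True
      then have "M s \<union> S s = insert (B s) K"
        unfolding M_s K_def by (auto simp: M_def)
      then show ?thesis using IH by simp
    next
      case False
      then have A': "?A' \<in> K" using col[OF s] unfolding K_def M_def by auto
      have "insert (B s \<union> ?A') (insert (B s) K - {B s, ?A'}) = M s \<union> S s"
        using notin A'_notin unfolding M_s K_def by auto
      with IH have "collapsible ?H d (insert (B s \<union> ?A') (insert (B s) K - {B s, ?A'}))"
        by (simp only:)
      then show ?thesis
        by (rule collapsible.merge[OF narrow, rotated 3]) (use A' notin in \<open>metis insertCI\<close>)+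
    qed
    then have "collapsible ?H d (singletons (B s) \<union> K)"
      using blocks[OF s] sep_BK finS finM
      by (intro collapsible_in_context[of _ _ _ u v]) (auto simp: K_def)
    moreover have "singletons (B s) \<union> K = M (Suc s) \<union> S (Suc s)"
      unfolding K_def S_def by (simp add: lessThan_Suc image_Un Un_ac)
    ultimately show ?case by simp
  qed
  from this[of N] have "collapsible ?H d (M N \<union> S N)" by simp
  moreover have "M N = {}" unfolding M_def A_def by auto
  ultimately show ?thesis unfolding S_def by simp
qed

section \<open>Effect of a swap, and a lower bound from spread points\<close>

text \<open>The swap can affect only the homogeneity of the part of \<open>i\<close> with the part of \<open>j\<close>.\<close>

lemma collapsible_adjacent_swap:
  fixes u u' :: "'i \<Rightarrow> 'x::linorder"
  assumes "collapsible (homog u v) d F" "partition_on I F"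
    and swap: "\<And>a b. a \<in> I \<Longrightarrow> b \<in> I \<Longrightarrow> {a, b} \<noteq> {i, j} \<Longrightarrow> u a < u b \<Longrightarrow> u' a < u' b"
  shows "collapsible (homog u' v) (Suc d) F"
  using assms(1,2)
proof (induction rule: collapsible.induct)
  case (single A)
  then show ?case by (intro collapsible_card_le) auto
next
  case (merge F A B)
  have fin: "finite F"
    using collapsible_finite[OF merge.hyps(5)] by auto
  have sub: "C \<subseteq> I" if "C \<in> F" for C
    using merge.prems that unfolding partition_on_def by blast
  have disj: "C \<inter> C' = {}" if "C \<in> F" "C' \<in> F" "C \<noteq> C'" for C C'
    using merge.prems that by (meson disjointD partition_onD2)
  have "narrow (homog u' v) (Suc d) F"
    unfolding narrow_def
  proof
    fix C assume C: "C \<in> F"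
    \<comment> \<open>\<open>E\<close> collects the parts whose relation to \<open>C\<close> the
      swap may destroy. As parts are disjoint, there is at most one: if \<open>C\<close> contains
      one of \<open>i\<close> and \<open>j\<close>, it is the part of the other.\<close>
    define E where "E = {C' \<in> F. C' \<noteq> C \<and> (i \<in> C \<and> j \<in> C' \<or> j \<in> C \<and> i \<in> C')}"
    have "X = Y" if X: "X \<in> E" and Y: "Y \<in> E" for X Y
    proof (rule ccontr)
      assume "X \<noteq> Y"
      then have "X \<inter> Y = {}" "X \<inter> C = {}" "Y \<inter> C = {}"
        using disj X Y C unfolding E_def by auto
      then show False using X Y unfolding E_def by auto
    qed
    then have cardE: "card E \<le> 1"
      using fin card_le_Suc0_iff_eq[of E] unfolding E_def by simp
    have "separated u' C C'" if "separated u C C'" "C' \<in> F" "C' \<noteq> C" "C' \<notin> E" for C'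
    proof -
      have *: "{a, b} \<noteq> {i, j}" if "a \<in> C" "b \<in> C'" for a b
        using that \<open>C' \<in> F\<close> \<open>C' \<noteq> C\<close> \<open>C' \<notin> E\<close> unfolding E_def by (auto simp: doubleton_eq_iff)
      have **: "{b, a} \<noteq> {i, j}" if "a \<in> C" "b \<in> C'" for a b
        using *[OF that] by (simp add: insert_commute)
      have in_I: "a \<in> I" "b \<in> I" if "a \<in> C" "b \<in> C'" for a b
        using sub C \<open>C' \<in> F\<close> that by blast+
      from that(1) show ?thesis
        unfolding separated_def
      proof
        assume "\<forall>a\<in>C. \<forall>b\<in>C'. u a < u b"
        then show "(\<forall>a\<in>C. \<forall>b\<in>C'. u' a < u' b) \<or> (\<forall>a\<in>C. \<forall>b\<in>C'. u' b < u' a)"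
          using swap[OF in_I *] by blast
      next
        assume "\<forall>a\<in>C. \<forall>b\<in>C'. u b < u a"
        then show "(\<forall>a\<in>C. \<forall>b\<in>C'. u' a < u' b) \<or> (\<forall>a\<in>C. \<forall>b\<in>C'. u' b < u' a)"
          using swap[OF in_I(2,1) **] by blast
      qed
    qed
    then have "{B \<in> F. B \<noteq> C \<and> \<not> homog u' v C B} \<subseteq> {B \<in> F. B \<noteq> C \<and> \<not> homog u v C B} \<union> E"
      unfolding homog_def by blast
    then have "card {B \<in> F. B \<noteq> C \<and> \<not> homog u' v C B} \<le> card ({B \<in> F. B \<noteq> C \<and> \<not> homog u v C B} \<union> E)"
      using fin unfolding E_def by (intro card_mono) auto
    also have "\<dots> \<le> card {B \<in> F. B \<noteq> C \<and> \<not> homog u v C B} + card E"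
      by (rule card_Un_le)
    also have "\<dots> < Suc d"
      using merge.hyps(1) C cardE unfolding narrow_def by fastforce
    finally show "card {B \<in> F. B \<noteq> C \<and> \<not> homog u' v C B} < Suc d" .
  qed
  moreover have "collapsible (homog u' v) (Suc d) (insert (A \<union> B) (F - {A, B}))"
    by (rule merge.IH[OF partition_on_merge[OF merge.prems merge.hyps(2-4)]])
  ultimately show ?case
    by (rule collapsible.merge[OF _ merge.hyps(2-4)])
qed

definition strictly_between :: "('i \<Rightarrow> 'x::linorder) \<Rightarrow> 'i \<Rightarrow> 'i \<Rightarrow> 'i \<Rightarrow> bool" where
  "strictly_between u g h z \<longleftrightarrow> u g < u z \<and> u z < u h \<or> u h < u z \<and> u z < u g"

text \<open>Look at the first merge that puts two points of \<open>G\<close> into the same part: all other points of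
  \<open>G\<close> still lie in different parts.\<close>

lemma collapsible_spread_lower_bound:
  assumes "collapsible (homog u v) d F" "partition_on I F" "finite G" "G \<subseteq> I"
    and "\<And>A g h. A \<in> F \<Longrightarrow> g \<in> A \<inter> G \<Longrightarrow> h \<in> A \<inter> G \<Longrightarrow> g = h"
    and "a \<in> G" "b \<in> G" "a \<noteq> b"
    and spread: "\<And>g h. g \<in> G \<Longrightarrow> h \<in> G \<Longrightarrow> g \<noteq> h \<Longrightarrow>
      \<exists>Z\<subseteq>G. card Z = e \<and> ((\<forall>z\<in>Z. strictly_between u g h z) \<or> (\<forall>z\<in>Z. strictly_between v g h z))"
  shows "e < d"
  using assms(1-8)
proof (induction rule: collapsible.induct)
  case (single A)
  then have "a \<in> A \<inter> G" "b \<in> A \<inter> G" unfolding partition_on_def by auto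
  then show ?case using single.prems by blast
next
  case (merge F A B)
  let ?F = "insert (A \<union> B) (F - {A, B})"
  note part = partition_on_merge[OF merge.prems(1) merge.hyps(2-4)]
  show ?case
  proof (cases "\<exists>g\<in>A \<inter> G. \<exists>h\<in>B \<inter> G. g \<noteq> h")
    case False
    have "g = h" if "C \<in> ?F" "g \<in> C \<inter> G" "h \<in> C \<inter> G" for C g h
    proof (cases "C \<in> F")
      case True
      then show ?thesis using merge.prems(4) that by blast
    next
      case notin: False
      have "g' = h'" if "g' \<in> A \<inter> G" "h' \<in> B \<inter> G" for g' h' using False that by blast
      moreover have "C = A \<union> B" using notin that(1) by blast
      ultimately show ?thesis
        using that(2,3) merge.prems(4)[OF merge.hyps(2), of g h] merge.prems(4)[OF merge.hyps(3), of g h]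
        by (metis Int_iff UnE)
    qed
    then show ?thesis
      by (rule merge.IH[OF part merge.prems(2,3) _ merge.prems(5-7)])
  next
    case True
    then obtain g h where gh: "g \<in> A \<inter> G" "h \<in> B \<inter> G" "g \<noteq> h" by blast
    obtain Z where Z: "Z \<subseteq> G" "card Z = e"
      "(\<forall>z\<in>Z. strictly_between u g h z) \<or> (\<forall>z\<in>Z. strictly_between v g h z)"
      using spread[of g h] gh by blast
    have "finite ?F" by (rule collapsible_finite[OF merge.hyps(5)])
    have AB: "A \<inter> G = {g}" "B \<inter> G = {h}"
      using gh merge.prems(4) merge.hyps(2,3) by blast+
    have notAB: "z \<notin> A \<union> B" if "z \<in> Z" for z
    proof -
      have "z \<noteq> g" "z \<noteq> h" using Z(3) that unfolding strictly_between_def by auto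
      then show ?thesis using AB Z(1) that by blast
    qed
    have "\<exists>C\<in>F. z \<in> C" if "z \<in> Z" for z
      using that Z(1) merge.prems(1,3) unfolding partition_on_def by blast
    \<comment> \<open>The parts of the points of \<open>Z\<close> are distinct, because before this
      merge points of \<open>G\<close> lie in different parts. Each of them is a red neighbour of
      \<open>A \<union> B\<close>: it has a point strictly between \<open>g\<close> and
      \<open>h\<close> in one coordinate.\<close>
    then obtain cl where cl: "cl z \<in> F" "z \<in> cl z" if "z \<in> Z" for z by metis
    have "inj_on cl Z"
    proof (rule inj_onI)
      fix y z assume "y \<in> Z" "z \<in> Z" "cl y = cl z"
      then show "y = z" using merge.prems(4)[of "cl y" y z] cl Z(1) by auto
    qed
    then have "e = card (cl ` Z)" using Z(2) by (simp add: card_image)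
    also have "\<dots> \<le> card {C \<in> ?F. C \<noteq> A \<union> B \<and> \<not> homog u v (A \<union> B) C}"
    proof (intro card_mono subsetI)
      show "finite {C \<in> ?F. C \<noteq> A \<union> B \<and> \<not> homog u v (A \<union> B) C}"
        using \<open>finite ?F\<close> by simp
      fix C assume "C \<in> cl ` Z"
      then obtain z where z: "z \<in> Z" "C = cl z" by blast
      have "\<not> homog u v (A \<union> B) C"
      proof
        assume H: "homog u v (A \<union> B) C"
        have mem: "g \<in> A \<union> B" "h \<in> A \<union> B" "z \<in> C" using gh cl z by auto
        have "strictly_between u g h z \<or> strictly_between v g h z" using Z(3) z(1) by blast
        moreover have "(u g < u z \<and> u h < u z) \<or> (u z < u g \<and> u z < u h)"
          "(v g < v z \<and> v h < v z) \<or> (v z < v g \<and> v z < v h)"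
          using H mem unfolding homog_def separated_def by blast+
        ultimately show False unfolding strictly_between_def by auto
      qed
      then show "C \<in> {C \<in> ?F. C \<noteq> A \<union> B \<and> \<not> homog u v (A \<union> B) C}"
        using z cl notAB[of z] by auto
    qed
    also have "\<dots> < d"
      using collapsible_narrow[OF merge.hyps(5)] unfolding narrow_def by blast
    finally show ?thesis .
  qed
qed

section \<open>Twin-width in terms of set partitions\<close>

lemma hull_Un_hulls: "P hull (P hull S \<union> P hull T) = P hull (S \<union> T)"
proof -
  have "{X. P X \<and> P hull S \<union> P hull T \<subseteq> X} = {X. P X \<and> S \<union> T \<subseteq> X}"
    by (intro Collect_cong conj_cong refl) (simp add: subset_hull)
  then have "\<Inter>{X. P X \<and> P hull S \<union> P hull T \<subseteq> X} = \<Inter>{X. P X \<and> S \<union> T \<subseteq> X}"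
    by (rule arg_cong)
  then show ?thesis
    unfolding hull_def[symmetric] .
qed

lemma Min_image_le_Max_image:
  fixes f :: "'i \<Rightarrow> 'x::linorder"
  assumes "finite A" "A \<noteq> {}"
  shows "Min (f ` A) \<le> Max (f ` A)"
  using assms by (metis Max_ge Min_in finite_imageI image_is_empty)

section \<open>Partitions of a finite point set and their bounding boxes\<close>

locale point_family =
  fixes I :: "'i set" and u v :: "'i \<Rightarrow> real"
  assumes finite_I: "finite I" and nonempty_I: "I \<noteq> {}"
    and inj_u: "inj_on u I" and inj_v: "inj_on v I"
begin

definition box :: "'i set \<Rightarrow> region" where
  "box A = bounding_box ((\<lambda>i. (u i, v i)) ` A)"

lemma box_eq:
  assumes "finite A" "A \<noteq> {}"
  shows "box A = {Min (u ` A)..Max (u ` A)} \<times> {Min (v ` A)..Max (v ` A)}" (is "_ = ?R")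
proof -
  have "axis_rectangle ?R"
    unfolding axis_rectangle_def using Min_image_le_Max_image[OF assms] by blast
  moreover have "(\<lambda>i. (u i, v i)) ` A \<subseteq> ?R" using assms by auto
  moreover have "?R \<subseteq> T" if T: "(\<lambda>i. (u i, v i)) ` A \<subseteq> T" "axis_rectangle T" for T
  proof -
    obtain a b c d where T_eq: "T = {a..b} \<times> {c..d}"
      using T(2) unfolding axis_rectangle_def by blast
    have "u ` A \<subseteq> {a..b}" "v ` A \<subseteq> {c..d}"
      using T(1) unfolding T_eq by auto
    then have "a \<le> Min (u ` A)" "Max (u ` A) \<le> b" "c \<le> Min (v ` A)" "Max (v ` A) \<le> d"
      using assms by auto
    then show ?thesis unfolding T_eq by auto
  qed
  ultimately show ?thesis
    unfolding box_def bounding_box_def by (intro hull_unique)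
qed

lemma box_singleton: "box {i} = {(u i, v i)}"
  by (simp add: box_eq)

lemma box_Un: "bounding_box (box A \<union> box B) = box (A \<union> B)"
  unfolding box_def bounding_box_def image_Un by (rule hull_Un_hulls)

lemma intervals_disjoint_iff:
  fixes f :: "'i \<Rightarrow> real"
  assumes "finite A" "A \<noteq> {}" "finite B" "B \<noteq> {}"
  shows "{Min (f ` A)..Max (f ` A)} \<inter> {Min (f ` B)..Max (f ` B)} = {} \<longleftrightarrow> separated f A B"
proof -
  have le: "Min (f ` A) \<le> Max (f ` A)" "Min (f ` B) \<le> Max (f ` B)"
    using Min_image_le_Max_image assms by blast+
  have "{Min (f ` A)..Max (f ` A)} \<inter> {Min (f ` B)..Max (f ` B)} = {} \<longleftrightarrow>
      Max (f ` A) < Min (f ` B) \<or> Max (f ` B) < Min (f ` A)"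
    using le by (auto simp: max_def min_def)
  also have "\<dots> \<longleftrightarrow> separated f A B"
    using assms unfolding separated_def by auto
  finally show ?thesis .
qed

lemma homogeneous_box:
  assumes "finite A" "A \<noteq> {}" "finite B" "B \<noteq> {}"
  shows "homogeneous (box A) (box B) \<longleftrightarrow> homog u v A B"
proof -
  have le: "Min (u ` A) \<le> Max (u ` A)" "Min (u ` B) \<le> Max (u ` B)"
    "Min (v ` A) \<le> Max (v ` A)" "Min (v ` B) \<le> Max (v ` B)"
    using Min_image_le_Max_image assms by blast+
  then show ?thesis
    unfolding homogeneous_def box_eq[OF assms(1,2)] box_eq[OF assms(3,4)] homog_def
    by (simp add: intervals_disjoint_iff[OF assms, symmetric])
qed

lemma partition_parts:
  assumes "partition_on I F" "A \<in> F"
  shows "finite A" "A \<noteq> {}" "A \<subseteq> I"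
proof -
  show "A \<subseteq> I" "A \<noteq> {}" using assms unfolding partition_on_def by blast+
  then show "finite A" using finite_I finite_subset by blast
qed

text \<open>Equal boxes have the same least first coordinate. It is attained in both parts, by the
  same point as \<open>u\<close> is injective, whereas distinct parts are disjoint. So a set of
  boxes never loses a part.\<close>

lemma inj_on_box:
  assumes "partition_on I F"
  shows "inj_on box F"
proof (rule inj_onI, rule ccontr)
  fix A B assume *: "A \<in> F" "B \<in> F" "box A = box B" "A \<noteq> B"
  note A = partition_parts[OF assms *(1)] and B = partition_parts[OF assms *(2)]
  have le: "Min (u ` A) \<le> Max (u ` A)" "Min (v ` A) \<le> Max (v ` A)"
    using Min_image_le_Max_image A(1,2) by blast+
  have "{Min (u ` A)..Max (u ` A)} = {Min (u ` B)..Max (u ` B)}"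
    using *(3) le unfolding box_eq[OF A(1,2)] box_eq[OF B(1,2)] by (simp add: times_eq_iff)
  then have "Min (u ` A) = Min (u ` B)" using le by (simp add: Icc_eq_Icc)
  then have "Min (u ` A) \<in> u ` A" "Min (u ` A) \<in> u ` B"
    using A B by (metis Min_in finite_imageI image_is_empty)+
  then obtain a b where "a \<in> A" "b \<in> B" "u a = u b" by (metis imageE)
  then have "A \<inter> B \<noteq> {}"
    using inj_onD[OF inj_u, of a b] A(3) B(3) by blast
  then show False using * disjointD[OF partition_onD2[OF assms]] by blast
qed

lemma red_degree_box:
  assumes "partition_on I F" "A \<in> F"
  shows "red_degree (box ` F) (box A) = card {B \<in> F. B \<noteq> A \<and> \<not> homog u v A B}"
proof -
  note inj = inj_on_box[OF assms(1)]
  have "box B \<noteq> box A \<longleftrightarrow> B \<noteq> A" "homogeneous (box A) (box B) \<longleftrightarrow> homog u v A B" if "B \<in> F" for B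
  proof -
    show "box B \<noteq> box A \<longleftrightarrow> B \<noteq> A" using inj_onD[OF inj _ that assms(2)] by auto
    show "homogeneous (box A) (box B) \<longleftrightarrow> homog u v A B"
      by (intro homogeneous_box partition_parts(1,2)[OF assms(1)] that assms(2))
  qed
  then have "{R \<in> box ` F. R \<noteq> box A \<and> \<not> homogeneous (box A) R} = box ` {B \<in> F. B \<noteq> A \<and> \<not> homog u v A B}"
    by auto
  moreover have "inj_on box {B \<in> F. B \<noteq> A \<and> \<not> homog u v A B}"
    by (rule inj_on_subset[OF inj]) blast
  ultimately show ?thesis
    unfolding red_degree_def by (simp only: card_image)
qed

lemma narrow_box_iff:
  assumes "partition_on I F"
  shows "narrow (homog u v) d F \<longleftrightarrow> (\<forall>R\<in>box ` F. red_degree (box ` F) R < d)"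
  unfolding narrow_def using red_degree_box[OF assms] by auto

lemma merge_box:
  assumes "partition_on I F" "A \<in> F" "B \<in> F"
  shows "insert (bounding_box (box A \<union> box B)) (box ` F - {box A, box B}) =
    box ` insert (A \<union> B) (F - {A, B})"
  using inj_on_image_set_diff[OF inj_on_box[OF assms(1)], of F "{A, B}"] assms(2,3)
  by (simp add: box_Un)

text \<open>The start is an arbitrary partition, since the induction continues from the family after
  a merge.\<close>

lemma merge_sequence_if_collapsible:
  assumes "collapsible (homog u v) d F" "partition_on I F"
  shows "\<exists>R. R 1 = box ` F \<and> (\<forall>i\<in>{1..<card F}. merges_to (R i) (R (Suc i))) \<and>
    is_singleton (R (card F)) \<and> (\<forall>i\<in>{1..card F}. \<forall>A\<in>R i. red_degree (R i) A < d)"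
  using assms
proof (induction rule: collapsible.induct)
  case (single A)
  then have "\<forall>R\<in>box ` {A}. red_degree (box ` {A}) R < d" using narrow_box_iff by blast
  then show ?case
    by (intro exI[of _ "\<lambda>_. box ` {A}"]) (simp add: is_singleton_def)
next
  case (merge F A B)
  let ?F = "insert (A \<union> B) (F - {A, B})"
  have part: "partition_on I ?F"
    using partition_on_merge[OF merge.prems merge.hyps(2-4)] .
  have card: "card F = Suc (card ?F)"
    using partition_on_merge_card[OF merge.prems finite_I merge.hyps(2-4)] .
  have "finite ?F" by (rule collapsible_finite[OF merge.hyps(5)])
  then have pos: "card ?F > 0" by (metis card_gt_0_iff insert_not_empty)
  obtain R where R: "R 1 = box ` ?F" "\<forall>i\<in>{1..<card ?F}. merges_to (R i) (R (Suc i))"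
    "is_singleton (R (card ?F))" "\<forall>i\<in>{1..card ?F}. \<forall>A\<in>R i. red_degree (R i) A < d"
    using merge.IH[OF part] by blast
  \<comment> \<open>\<open>Q\<close> is \<open>R\<close> delayed by one, with the family before the
    merge put in front.\<close>
  define Q where "Q i = (if i = 1 then box ` F else R (i - 1))" for i
  have "box A \<noteq> box B"
    using inj_on_box[OF merge.prems] merge.hyps(2-4) by (meson inj_onD)
  then have first: "merges_to (box ` F) (box ` ?F)"
    unfolding merges_to_def merge_box[OF merge.prems merge.hyps(2,3), symmetric]
    using merge.hyps(2,3) by blast
  have "merges_to (Q i) (Q (Suc i))" if "i \<in> {1..<card F}" for i
  proof (cases "i = 1")
    case True
    then show ?thesis using first R(1) unfolding Q_def by simp
  next
    case False
    then have "i - 1 \<in> {1..<card ?F}" "Suc (i - 1) = i" using that card by auto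
    then show ?thesis using R(2) False unfolding Q_def by force
  qed
  moreover have "red_degree (Q i) C < d" if "i \<in> {1..card F}" "C \<in> Q i" for i C
  proof (cases "i = 1")
    case True
    then show ?thesis
      using that narrow_box_iff[OF merge.prems] merge.hyps(1) unfolding Q_def by auto
  next
    case False
    then have "i - 1 \<in> {1..card ?F}" using that card by auto
    then show ?thesis using R(4) False that unfolding Q_def by force
  qed
  moreover have "is_singleton (Q (card F))" using R(3) card pos unfolding Q_def by simp
  moreover have "Q 1 = box ` F" unfolding Q_def by simp
  ultimately show ?case by blast
qed

text \<open>Induction on the number \<open>m\<close> of merges left. Every \<open>R i\<close> is the
  set of boxes of a partition: two merged boxes come from two parts, and their bounding box is the
  box of the union.\<close>

lemma collapsible_if_merge_sequence:
  assumes "i + m = n" "i \<ge> 1"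
    and "\<And>i. i \<in> {1..<n} \<Longrightarrow> merges_to (R i) (R (Suc i))" "is_singleton (R n)"
    and "\<And>i A. i \<in> {1..n} \<Longrightarrow> A \<in> R i \<Longrightarrow> red_degree (R i) A < d"
    and "partition_on I F" "R i = box ` F"
  shows "collapsible (homog u v) d F"
  using assms(1,2,6,7)
proof (induction m arbitrary: i F)
  case 0
  obtain Q where "box ` F = {Q}" using 0 assms(4) by (auto simp: is_singleton_def)
  then obtain A where "F = {A}"
    using inj_on_box[OF 0(3)] by (metis card_1_singletonE card_image is_singletonI is_singleton_altdef)
  moreover have "narrow (homog u v) d F"
    unfolding narrow_box_iff[OF 0(3)] using 0 assms(5)[of i] by auto
  ultimately show ?case by (auto intro: collapsible.single)
next
  case (Suc m)
  have narrow: "narrow (homog u v) d F"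
    unfolding narrow_box_iff[OF Suc.prems(3)] using Suc.prems assms(5)[of i] by auto
  have "merges_to (box ` F) (R (Suc i))" using assms(3)[of i] Suc.prems by auto
  then obtain A B where AB: "A \<in> F" "B \<in> F" "box A \<noteq> box B"
    "R (Suc i) = insert (bounding_box (box A \<union> box B)) (box ` F - {box A, box B})"
    unfolding merges_to_def by blast
  then have "A \<noteq> B" by blast
  have "R (Suc i) = box ` insert (A \<union> B) (F - {A, B})"
    using AB merge_box[OF Suc.prems(3)] by simp
  then have "collapsible (homog u v) d (insert (A \<union> B) (F - {A, B}))"
    using Suc.prems(1,2) by (intro Suc.IH[of "Suc i"] partition_on_merge[OF Suc.prems(3) AB(1,2) \<open>A \<noteq> B\<close>]) auto
  then show ?case
    by (rule collapsible.merge[OF narrow AB(1,2) \<open>A \<noteq> B\<close>])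
qed

lemma twin_width_eq:
  "twin_width ((\<lambda>i. (u i, v i)) ` I) = (LEAST d. collapsible (homog u v) d (singletons I))"
proof -
  let ?P = "(\<lambda>i. (u i, v i)) ` I"
  have "inj_on (\<lambda>i. (u i, v i)) I" using inj_u unfolding inj_on_def by auto
  then have card: "card ?P = card (singletons I)"
    by (simp add: card_image)
  have start: "(\<lambda>p. {p}) ` ?P = box ` singletons I"
    by (simp add: image_image box_singleton)
  note part = partition_on_singletons[of I]
  have pos: "card ?P \<ge> 1"
    using finite_I nonempty_I by (simp add: Suc_leI card_gt_0_iff)
  have "(\<exists>R. merge_sequence ?P R \<and> wide d ?P R) \<longleftrightarrow> collapsible (homog u v) d (singletons I)" for d
  proof
    assume "\<exists>R. merge_sequence ?P R \<and> wide d ?P R"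
    then obtain R where "merge_sequence ?P R" "wide d ?P R" by blast
    then show "collapsible (homog u v) d (singletons I)"
      using pos part start unfolding merge_sequence_def wide_def
      by (intro collapsible_if_merge_sequence[of 1 "card ?P - 1" "card ?P" R d]) auto
  next
    assume "collapsible (homog u v) d (singletons I)"
    from merge_sequence_if_collapsible[OF this part]
    show "\<exists>R. merge_sequence ?P R \<and> wide d ?P R"
      unfolding merge_sequence_def wide_def start card by blast
  qed
  then show ?thesis unfolding twin_width_def by simp
qed

end

section \<open>Twin-width of sequences\<close>

definition collapsible_list :: "nat \<Rightarrow> real list \<Rightarrow> bool" where
  "collapsible_list d X \<longleftrightarrow> collapsible (homog (\<lambda>i. i) (nth X)) d (singletons {..<length X})"

text \<open>Homogeneity depends only on the order of the abscissas, so the list index can replace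
  the abscissa of the point.\<close>

lemma seq_twin_width_eq:
  assumes "distinct X" "X \<noteq> []"
  shows "seq_twin_width X = (LEAST d. collapsible_list d X)"
proof -
  define u where "u i = real (Suc i) / real (length X)" for i
  have mono: "u i < u j \<longleftrightarrow> i < j" for i j
    using assms(2) by (simp add: u_def divide_less_cancel)
  interpret point_family "{..<length X}" u "nth X"
  proof
    show "inj_on u {..<length X}" by (rule inj_onI) (metis mono linorder_neq_iff)
    show "inj_on ((!) X) {..<length X}" by (rule inj_on_nth) (use assms in auto)
  qed (use assms in auto)
  have "seq_points X = (\<lambda>i. (u i, X ! i)) ` {..<length X}"
    unfolding seq_points_def image_Suc_lessThan[symmetric] image_image u_def by simp
  moreover have "homog u (nth X) = homog (\<lambda>i. i) (nth X)"
    by (intro ext) (simp add: homog_def separated_def mono)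
  ultimately show ?thesis
    using twin_width_eq unfolding seq_twin_width_def collapsible_list_def by simp
qed

lemma collapsible_mono:
  assumes "collapsible H d F" "d \<le> d'"
  shows "collapsible H d' F"
  using assms(1)
proof (induction rule: collapsible.induct)
  case (single A)
  then show ?case using assms(2) by (intro collapsible.single) (fastforce simp: narrow_def)
next
  case (merge F A B)
  have "narrow H d' F" using merge.hyps(1) assms(2) less_le_trans unfolding narrow_def by blast
  then show ?case by (rule collapsible.merge[OF _ merge.hyps(2-4) merge.IH])
qed

lemma seq_twin_width_le:
  assumes "distinct X" "X \<noteq> []" "collapsible_list d X"
  shows "seq_twin_width X \<le> d"
  unfolding seq_twin_width_eq[OF assms(1,2)] using assms(3) by (rule Least_le)

lemma seq_twin_width_eqI:
  assumes "distinct X" "X \<noteq> []" "collapsible_list d X" "\<not> collapsible_list (d - 1) X"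
  shows "seq_twin_width X = d"
  unfolding seq_twin_width_eq[OF assms(1,2)]
proof (rule Least_equality)
  fix e assume e: "collapsible_list e X"
  show "d \<le> e"
  proof (rule ccontr)
    assume "\<not> d \<le> e"
    then have "e \<le> d - 1" by simp
    then show False using e assms(4) collapsible_mono unfolding collapsible_list_def by blast
  qed
qed (fact assms(3))

lemma collapsible_list_transfer:
  assumes "collapsible_list d X" "length X = length Y"
    and "\<And>i j. i < length X \<Longrightarrow> j < length X \<Longrightarrow> X ! i < X ! j \<Longrightarrow> Y ! i < Y ! j"
  shows "collapsible_list d Y"
  using collapsible_singletons_image[of "\<lambda>i. i" "nth X" d "{..<length X}" "\<lambda>i. i" "\<lambda>i. i" "nth Y"] assms
  unfolding collapsible_list_def by simp

lemma collapsible_list_map_upt: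
  assumes "collapsible (homog (\<lambda>i. i) f) d (singletons {..<n})"
  shows "collapsible_list d (map f [0..<n])"
  using collapsible_singletons_image[of "\<lambda>i. i" f d "{..<n}" "\<lambda>i. i" "\<lambda>i. i" "nth (map f [0..<n])"] assms
  unfolding collapsible_list_def by simp

text \<open>Each new point lies above and to the right of all earlier ones. The earlier points and
  the new one are thus two blocks of one colour for \<open>collapsible_blocks\<close>. The case
  \<open>m = 0\<close> starts from no points, and the empty family is not collapsible; hence the
  premise \<open>m > 0\<close> on the prefix.\<close>

lemma collapsible_increasing_tail:
  fixes f :: "nat \<Rightarrow> real"
  assumes "m \<le> n" "d > 0" "n > 0"
    and "m > 0 \<Longrightarrow> collapsible (homog (\<lambda>i. i) f) d (singletons {..<m})" "inj_on f {..<m}"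
    and "\<And>i j. i < j \<Longrightarrow> m \<le> j \<Longrightarrow> j < n \<Longrightarrow> f i < f j"
  shows "collapsible (homog (\<lambda>i. i) f) d (singletons {..<n}) \<and> inj_on f {..<n}"
  using assms(1,3,6)
proof (induction rule: dec_induct)
  case base
  then show ?case using assms(4,5) by simp
next
  case (step l)
  have below: "f i < f l" if "i < l" for i using step.prems(2)[of i l] that step.hyps(1) by simp
  have inj_l: "inj_on f {..<l}"
  proof (cases "l = 0")
    case False
    then show ?thesis using step.IH step.prems(2) by simp
  qed simp
  have inj: "inj_on f {..<Suc l}"
  proof -
    have "f l \<notin> f ` {..<l}" using below by fastforce
    then show ?thesis using inj_l by (simp add: lessThan_Suc)
  qed
  show ?case
  proof (cases "l = 0")
    case True
    then show ?thesis
      using inj assms(2) collapsible_card_le[of "{{0}}" d] by (simp add: lessThan_Suc)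
  next
    case False
    define B where "B s = (if s = 0 then {..<l} else {l})" for s :: nat
    have UN: "(\<Union>s<2. B s) = {..<Suc l}" unfolding B_def by (auto simp: numeral_2_eq_2 lessThan_Suc)
    have "collapsible (homog (\<lambda>i. i) f) d (singletons (\<Union>s<2. B s))"
    proof (rule collapsible_blocks[where col = "\<lambda>_. 0"])
      show "collapsible (homog (\<lambda>i. i) f) d (singletons (B s))" for s
        using False step.IH step.prems(2) assms(2) collapsible_card_le[of "{{l}}" d] unfolding B_def by auto
      show "inj_on (\<lambda>i. i) (\<Union>s<2. B s)" by simp
      show "inj_on f (\<Union>s<2. B s)" using inj UN by simp
      show "i < j" if "s < s'" "s' < 2" "i \<in> B s" "j \<in> B s'" for s s' i j
        using that unfolding B_def by (auto split: if_splits)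
      show "separated f (B s) (\<Union>(B ` {s'. s < s' \<and> s' < 2 \<and> 0 = c}))" if "s < 2" for s c
        using below unfolding separated_def B_def by auto
    qed (use False assms(2) in \<open>auto simp: B_def\<close>)
    then show ?thesis using inj UN by simp
  qed
qed

section \<open>Adjacent swaps and grids\<close>

definition adjacent_swap :: "'a list \<Rightarrow> 'a list \<Rightarrow> bool" where
  "adjacent_swap xs ys \<longleftrightarrow> (\<exists>us x y vs. xs = us @ x # y # vs \<and> ys = us @ y # x # vs)"

lemma adjacent_swap_append: "adjacent_swap xs ys \<Longrightarrow> adjacent_swap (ws @ xs) (ws @ ys)"
  unfolding adjacent_swap_def by (metis append.assoc)

lemma adjacent_swaps_append:
  "adjacent_swap\<^sup>*\<^sup>* xs ys \<Longrightarrow> adjacent_swap\<^sup>*\<^sup>* (ws @ xs) (ws @ ys)"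
  by (induction rule: rtranclp_induct) (auto intro: adjacent_swap_append rtranclp.rtrancl_into_rtrancl)

lemma adjacent_swaps_to_front: "adjacent_swap\<^sup>*\<^sup>* (x # us @ vs) (us @ x # vs)"
proof (induction us)
  case (Cons u us)
  have "adjacent_swap (x # u # us @ vs) (u # x # us @ vs)"
    unfolding adjacent_swap_def by (metis append_Nil)
  moreover have "adjacent_swap\<^sup>*\<^sup>* (u # x # us @ vs) (u # us @ x # vs)"
    using adjacent_swaps_append[OF Cons.IH, of "[u]"] by simp
  ultimately show ?case by simp
qed simp

text \<open>The tail is rearranged first; then the head is moved past the entries that precede it in
  \<open>ys\<close>.\<close>

lemma adjacent_swaps_if_mset_eq: "mset xs = mset ys \<Longrightarrow> adjacent_swap\<^sup>*\<^sup>* xs ys"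
proof (induction xs arbitrary: ys)
  case (Cons x xs)
  then have "x \<in> set ys" by (metis list.set_intros(1) set_mset_mset)
  then obtain us vs where ys: "ys = us @ x # vs" by (metis split_list)
  then have "adjacent_swap\<^sup>*\<^sup>* xs (us @ vs)" using Cons by simp
  then have "adjacent_swap\<^sup>*\<^sup>* (x # xs) (x # us @ vs)"
    using adjacent_swaps_append[of _ _ "[x]"] by simp
  then show ?case using adjacent_swaps_to_front[of x us vs] ys by simp
qed simp

lemma mset_adjacent_swap: "adjacent_swap xs ys \<Longrightarrow> mset ys = mset xs"
  by (auto simp: adjacent_swap_def)

lemma mset_adjacent_swaps: "adjacent_swap\<^sup>*\<^sup>* xs ys \<Longrightarrow> mset ys = mset xs"
  by (induction rule: rtranclp_induct) (simp_all add: mset_adjacent_swap)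

text \<open>Exchanging two neighbouring entries amounts to keeping the values of the points and
  replacing their index \<open>a\<close> by \<tau> a, where \<tau> is the transposition of
  \<open>i\<close> and \<open>Suc i\<close>. It reverses the order of this single pair of
  indices.\<close>

lemma collapsible_list_adjacent_swap:
  assumes "adjacent_swap X Y" "collapsible_list d X"
  shows "collapsible_list (Suc d) Y"
proof -
  obtain us x y vs where X: "X = us @ x # y # vs" and Y: "Y = us @ y # x # vs"
    using assms(1) unfolding adjacent_swap_def by blast
  define i where "i = length us"
  define \<tau> where "\<tau> a = (if a = i then Suc i else if a = Suc i then i else a)" for a
  let ?n = "length X"
  have i: "Suc i < ?n" unfolding X i_def by simp
  have \<tau>\<tau>: "\<tau> (\<tau> a) = a" for a unfolding \<tau>_def by auto
  have "\<tau> a < ?n" if "a < ?n" for a using that i unfolding \<tau>_def by auto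
  then have image: "\<tau> ` {..<?n} = {..<?n}"
    using \<tau>\<tau> by (metis (no_types, lifting) image_subset_iff image_eqI lessThan_iff subsetI subset_antisym)
  have nth: "Y ! \<tau> a = X ! a" for a
  proof -
    consider "a = i" | "a = Suc i" | "a < i" | r where "a = i + (2 + r)"
      by (metis Suc_lessI add_2_eq_Suc le_Suc_ex less_eq_Suc_le linorder_neqE_nat add_Suc_right add_Suc)
    then show ?thesis
    proof cases
      case 4
      then show ?thesis unfolding X Y \<tau>_def i_def by (simp add: nth_append)
    qed (auto simp: X Y \<tau>_def i_def nth_append)
  qed
  have "collapsible (homog \<tau> (nth X)) (Suc d) (singletons {..<?n})"
  proof (rule collapsible_adjacent_swap)
    show "collapsible (homog (\<lambda>i. i) (nth X)) d (singletons {..<?n})"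
      using assms(2) unfolding collapsible_list_def .
    show "\<tau> a < \<tau> b" if "{a, b} \<noteq> {i, Suc i}" "a < b" for a b
      using that unfolding \<tau>_def by (auto simp: doubleton_eq_iff)
  qed (rule partition_on_singletons)
  then have "collapsible (homog (\<lambda>i. i) (nth Y)) (Suc d) (singletons (\<tau> ` {..<?n}))"
    by (rule collapsible_singletons_image) (use \<tau>\<tau> nth in \<open>auto intro: inj_on_inverseI\<close>)
  then show ?thesis using image unfolding collapsible_list_def by (simp add: X Y)
qed

text \<open>A discrete intermediate value argument. At the first list of the chain where width
  \<open>d - 1\<close> fails, either the list is \<open>xs\<close> itself or its predecessor has
  width \<open>d - 1\<close>; in the second case one swap raises the width to at most
  \<open>d\<close>.\<close>

lemma intermediate_collapsible_list:
  assumes "adjacent_swap\<^sup>*\<^sup>* xs ys" "collapsible_list d (ws @ xs)" "\<not> collapsible_list (d - 1) (ws @ ys)" "d > 0"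
  shows "\<exists>zs. mset zs = mset xs \<and> collapsible_list d (ws @ zs) \<and> \<not> collapsible_list (d - 1) (ws @ zs)"
  using assms(1,3)
proof (induction rule: rtranclp_induct)
  case base
  then show ?case using assms(2) by blast
next
  case (step ys zs)
  show ?case
  proof (cases "collapsible_list (d - 1) (ws @ ys)")
    case True
    then have "collapsible_list d (ws @ zs)"
      using collapsible_list_adjacent_swap[OF adjacent_swap_append[OF step.hyps(2)]] assms(4) by fastforce
    moreover have "mset zs = mset xs"
      using mset_adjacent_swaps step.hyps by (metis rtranclp.rtrancl_into_rtrancl)
    ultimately show ?thesis using step.prems by blast
  qed (use step.IH in blast)
qed

section \<open>Transposed grids: exchange of the two base-\<open>q\<close> digits of a number below
  \<open>q * q\<close>\<close>

definition transpose_index :: "nat \<Rightarrow> nat \<Rightarrow> nat" where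
  "transpose_index q a = a mod q * q + a div q"

lemma transpose_index_less:
  assumes "a < q * q"
  shows "transpose_index q a < q * q"
proof -
  have "q > 0" using assms by (cases q) auto
  have "a div q < q" using assms by (simp add: less_mult_imp_div_less)
  then have "transpose_index q a < Suc (a mod q) * q" unfolding transpose_index_def by simp
  also have "\<dots> \<le> q * q" using \<open>q > 0\<close> by (intro mult_le_mono1) (simp add: Suc_leI)
  finally show ?thesis .
qed

lemma transpose_index_involution:
  assumes "a < q * q"
  shows "transpose_index q (transpose_index q a) = a"
proof -
  have "a div q < q" using assms by (simp add: less_mult_imp_div_less)
  then have "transpose_index q a mod q = a div q" "transpose_index q a div q = a mod q"
    unfolding transpose_index_def by simp_all
  then show ?thesis unfolding transpose_index_def[of q "transpose_index q a"] by simp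
qed

text \<open>Let \<open>x\<close> and \<open>y\<close> be the differences of the two digits. The one
  of larger absolute value is the leading one either before or after the transposition, and there
  the other one cannot bring the total difference below \<open>q - 1\<close>.\<close>

lemma transpose_index_spread:
  assumes "a < q * q" "b < q * q" "a \<noteq> b"
  shows "a + q \<le> b + 1 \<or> b + q \<le> a + 1 \<or>
    transpose_index q a + q \<le> transpose_index q b + 1 \<or> transpose_index q b + q \<le> transpose_index q a + 1"
proof -
  define x y where "x = int (a div q) - int (b div q)" and "y = int (a mod q) - int (b mod q)"
  have ab: "int a - int b = x * int q + y"
  proof -
    have "int a = int (a div q) * int q + int (a mod q)" "int b = int (b div q) * int q + int (b mod q)"
      by (metis div_mult_mod_eq of_nat_add of_nat_mult)+
    then show ?thesis unfolding x_def y_def by (simp add: algebra_simps)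
  qed
  have tab: "int (transpose_index q a) - int (transpose_index q b) = y * int q + x"
    unfolding x_def y_def transpose_index_def by (simp add: algebra_simps)
  have q: "q \<ge> 1" using assms(1) by (cases q) auto
  have key: "\<bar>s * int q + t\<bar> \<ge> int q - 1" if "\<bar>t\<bar> \<le> \<bar>s\<bar>" "s \<noteq> 0" for s t
  proof -
    have "int q - 1 \<le> \<bar>s\<bar> * (int q - 1)" using that(2) q mult_right_mono[of 1 "\<bar>s\<bar>" "int q - 1"] by simp
    also have "\<dots> \<le> \<bar>s * int q\<bar> - \<bar>t\<bar>" using that(1) by (simp add: abs_mult algebra_simps)
    finally show ?thesis by linarith
  qed
  have "x \<noteq> 0 \<or> y \<noteq> 0" using ab assms(3) by auto
  then have "\<bar>int a - int b\<bar> \<ge> int q - 1 \<or> \<bar>int (transpose_index q a) - int (transpose_index q b)\<bar> \<ge> int q - 1"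
    unfolding ab tab using key[of y x] key[of x y] by linarith
  then show ?thesis by linarith
qed

text \<open>By \<open>transpose_index_spread\<close> any two grid points have \<open>q - 2\<close>
  grid points strictly between them, in index or in value. So
  \<open>collapsible_spread_lower_bound\<close> applies, with the grid positions behind
  \<open>ws\<close> as the set \<open>G\<close>.\<close>

lemma not_collapsible_grid:
  assumes "\<And>i j. i < j \<Longrightarrow> j < q * q \<Longrightarrow> w i < w j" "q \<ge> 2"
  shows "\<not> collapsible_list (q - 2) (ws @ map (\<lambda>a. w (transpose_index q a)) [0..<q * q])"
proof
  define l where "l = length ws"
  let ?X = "ws @ map (\<lambda>a. w (transpose_index q a)) [0..<q * q]"
  let ?G = "{l..<l + q * q}"
  let ?t = "transpose_index q"
  have X: "?X ! (l + a) = w (?t a)" if "a < q * q" for a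
    using that unfolding l_def by (simp add: nth_append)
  have between: "\<exists>Z\<subseteq>?G. card Z = q - 2 \<and>
      ((\<forall>z\<in>Z. strictly_between (\<lambda>i. i) (l + a) (l + b) z) \<or> (\<forall>z\<in>Z. strictly_between (nth ?X) (l + a) (l + b) z))"
    if ab: "a < q * q" "b < q * q" "a + q \<le> b + 1 \<or> ?t a + q \<le> ?t b + 1" for a b
    using ab(3)
  proof
    assume "a + q \<le> b + 1"
    then have "q - 2 \<le> card {l + a<..<l + b}" by simp
    then obtain Z where "Z \<subseteq> {l + a<..<l + b}" "card Z = q - 2" by (meson obtain_subset_with_card_n)
    then show ?thesis using ab(2) by (intro exI[of _ Z]) (auto simp: strictly_between_def subset_iff)
  next
    assume "?t a + q \<le> ?t b + 1"
    then have "q - 2 \<le> card {?t a<..<?t b}" by simp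
    then obtain Y where Y: "Y \<subseteq> {?t a<..<?t b}" "card Y = q - 2" by (meson obtain_subset_with_card_n)
    have less: "y < q * q" "?t a < y" "y < ?t b" if "y \<in> Y" for y
    proof -
      show "?t a < y" "y < ?t b" using Y(1) that by auto
      then show "y < q * q" using transpose_index_less[OF ab(2)] by simp
    qed
    \<comment> \<open>The value \<open>w y\<close> stands at position \<open>l + ?t y\<close>, since
      the transposition is an involution.\<close>
    have "inj_on (\<lambda>y. l + ?t y) Y"
    proof (rule inj_onI)
      fix y z assume "y \<in> Y" "z \<in> Y" "l + ?t y = l + ?t z"
      then have "?t (?t y) = ?t (?t z)" by simp
      then show "y = z" using transpose_index_involution less(1) \<open>y \<in> Y\<close> \<open>z \<in> Y\<close> by metis
    qed
    then have "card ((\<lambda>y. l + ?t y) ` Y) = q - 2" using Y(2) by (simp add: card_image)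
    moreover have "(\<lambda>y. l + ?t y) ` Y \<subseteq> ?G" using less(1) transpose_index_less by auto
    moreover have "strictly_between (nth ?X) (l + a) (l + b) (l + ?t y)" if "y \<in> Y" for y
    proof -
      have "?X ! (l + ?t y) = w y"
        using X[OF transpose_index_less[OF less(1)[OF that]]] transpose_index_involution[OF less(1)[OF that]] by simp
      moreover have "w (?t a) < w y" "w y < w (?t b)"
        using assms(1) less[OF that] transpose_index_less[OF ab(2)] by blast+
      ultimately show ?thesis using X[OF ab(1)] X[OF ab(2)] unfolding strictly_between_def by simp
    qed
    ultimately show ?thesis by blast
  qed
  assume "collapsible_list (q - 2) ?X"
  then have "collapsible (homog (\<lambda>i. i) (nth ?X)) (q - 2) (singletons {..<length ?X})"
    unfolding collapsible_list_def .
  then have "q - 2 < q - 2"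
  proof (rule collapsible_spread_lower_bound[where G = ?G and a = l and b = "Suc l"])
    show "partition_on {..<length ?X} (singletons {..<length ?X})" by (rule partition_on_singletons)
    show "?G \<subseteq> {..<length ?X}" unfolding l_def by auto
    have "1 * 1 < q * q" using assms(2) by (intro mult_strict_mono) auto
    then show "l \<in> ?G" "Suc l \<in> ?G" using assms(2) by auto
    fix g h assume gh: "g \<in> ?G" "h \<in> ?G" "g \<noteq> h"
    define a b where "a = g - l" and "b = h - l"
    have ab: "a < q * q" "b < q * q" "a \<noteq> b" "g = l + a" "h = l + b"
      using gh unfolding a_def b_def by auto
    have sym: "strictly_between u y x z \<longleftrightarrow> strictly_between u x y z" for u :: "nat \<Rightarrow> real" and x y z
      unfolding strictly_between_def by auto
    have sym': "strictly_between u y x z \<longleftrightarrow> strictly_between u x y z" for u :: "nat \<Rightarrow> nat" and x y z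
      unfolding strictly_between_def by auto
    show "\<exists>Z\<subseteq>?G. card Z = q - 2 \<and>
        ((\<forall>z\<in>Z. strictly_between (\<lambda>i. i) g h z) \<or> (\<forall>z\<in>Z. strictly_between (nth ?X) g h z))"
      using transpose_index_spread[OF ab(1-3)] between[OF ab(1,2)]
        between[OF ab(2,1), unfolded sym[of _ "l + b"] sym'[of _ "l + b"]] unfolding ab(4,5) by blast
  qed auto
  then show False by simp
qed

lemma mset_map_transpose_index:
  "mset (map (\<lambda>a. w (transpose_index q a)) [0..<q * q]) = mset (map w [0..<q * q])"
proof -
  have "inj_on (transpose_index q) {0..<q * q}"
    by (rule inj_on_inverseI[of _ "transpose_index q"]) (simp add: transpose_index_involution)
  moreover have "transpose_index q ` {0..<q * q} = {0..<q * q}"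
  proof
    show "transpose_index q ` {0..<q * q} \<subseteq> {0..<q * q}" using transpose_index_less by auto
    show "{0..<q * q} \<subseteq> transpose_index q ` {0..<q * q}"
    proof
      fix a assume "a \<in> {0..<q * q}"
      then show "a \<in> transpose_index q ` {0..<q * q}"
        using transpose_index_less[of a q] transpose_index_involution[of a q]
        by (intro image_eqI[of _ _ "transpose_index q a"]) auto
    qed
  qed
  ultimately have "mset (map (transpose_index q) [0..<q * q]) = mset [0..<q * q]"
    by (intro set_eq_iff_mset_eq_distinct[THEN iffD1]) (simp_all add: distinct_map)
  then have "image_mset w (mset (map (transpose_index q) [0..<q * q])) = image_mset w (mset [0..<q * q])"
    by (rule arg_cong)
  then show ?thesis by (simp add: multiset.map_comp comp_def)
qed

section \<open>The hard requests\<close>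

text \<open>The requests of a level visit \<open>D\<close> rows cyclically for \<open>T\<close> rounds. Even rows are filled
  upwards and odd rows downwards, so that the rows \<open>2 * i\<close> and \<open>2 * i + 1\<close> converge to each other and,
  merged from right to left, cost only one non-trivial part.\<close>

definition cell :: "nat \<Rightarrow> nat \<Rightarrow> nat \<Rightarrow> nat" where
  "cell D T s = 2 * T * (s mod D) + (if even (s mod D) then s div D else T - 1 - s div D)"

text \<open>Time is read in base \<open>D * T\<close>: the leading digit numbers the visit, and the
  remaining digits give the time inside a level-\<open>h\<close> copy that fits into one cell of
  height \<open>1 / (2 * D * T)\<close>.\<close>

fun hard_request :: "nat \<Rightarrow> nat \<Rightarrow> nat \<Rightarrow> nat \<Rightarrow> real" where
  "hard_request D T 0 q = 0"
| "hard_request D T (Suc h) q =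
     (real (cell D T (q div (D * T) ^ h)) + hard_request D T h (q mod (D * T) ^ h)) / real (2 * D * T)"

lemma cell_row:
  assumes "s < D * T"
  shows "2 * T * (s mod D) \<le> cell D T s" "cell D T s < 2 * T * (s mod D) + T"
proof -
  have "s div D < T" using assms by (simp add: less_mult_imp_div_less mult.commute)
  then show "2 * T * (s mod D) \<le> cell D T s" "cell D T s < 2 * T * (s mod D) + T"
    unfolding cell_def by auto
qed

lemma cell_less_if_row_less:
  assumes "s < D * T" "s' < D * T" "s mod D < s' mod D"
  shows "cell D T s < cell D T s'"
proof -
  have "2 * T * Suc (s mod D) \<le> 2 * T * (s' mod D)"
    using assms(3) by (intro mult_le_mono2) simp
  then show ?thesis using cell_row[OF assms(1)] cell_row[OF assms(2)] by simp
qed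

lemma cell_less: 
  assumes "s < D * T"
  shows "cell D T s < 2 * D * T"
proof -
  have "D > 0" using assms by (cases D) auto
  then have "2 * T * Suc (s mod D) \<le> 2 * T * D" by (intro mult_le_mono2) (simp add: Suc_leI)
  then show ?thesis using cell_row(2)[OF assms] by (simp add: mult.commute mult.left_commute)
qed

text \<open>The colours are the pairs of rows. Within a pair the even row rises and the odd one
  falls, so all later visits to the pair lie on the inner side of the current one. Thus the side
  depends on \<open>s\<close> and the colour of \<open>s'\<close> only, which is what
  \<open>collapsible_blocks\<close> asks for.\<close>

lemma cell_order:
  assumes "s < s'" "s' < (2 * d) * T"
  defines "c \<equiv> (s mod (2 * d)) div 2" and "c' \<equiv> (s' mod (2 * d)) div 2"
  shows "c < c' \<or> c = c' \<and> even (s mod (2 * d)) \<Longrightarrow> cell (2 * d) T s < cell (2 * d) T s'"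
    and "\<not> (c < c' \<or> c = c' \<and> even (s mod (2 * d))) \<Longrightarrow> cell (2 * d) T s' < cell (2 * d) T s"
proof -
  let ?D = "2 * d"
  let ?r = "s mod ?D" and ?r' = "s' mod ?D"
  have pairs: "x div 2 < y div 2 \<or> x div 2 = y div 2 \<and> even x \<Longrightarrow> x \<noteq> y \<Longrightarrow> x < y"
    "\<not> (x div 2 < y div 2 \<or> x div 2 = y div 2 \<and> even x) \<Longrightarrow> x \<noteq> y \<Longrightarrow> y < x" for x y :: nat
    by presburger+
  have s: "s < ?D * T" using assms by simp
  have t': "s' div ?D < T" using assms(2) by (simp add: less_mult_imp_div_less mult.commute)
  have lt: "s div ?D < s' div ?D" if "?r = ?r'"
  proof -
    have "s div ?D \<le> s' div ?D" using assms(1) by (intro div_le_mono) simp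
    moreover have "s div ?D \<noteq> s' div ?D"
      using that assms(1) by (metis div_mult_mod_eq less_irrefl)
    ultimately show ?thesis by simp
  qed
  show "cell ?D T s < cell ?D T s'" if up: "c < c' \<or> c = c' \<and> even ?r"
  proof (cases "?r = ?r'")
    case True
    then have "even ?r" using up unfolding c_def c'_def by auto
    then show ?thesis using True lt unfolding cell_def by simp
  next
    case False
    then have "?r < ?r'" using up pairs(1) unfolding c_def c'_def by blast
    then show ?thesis using cell_less_if_row_less s assms(2) by blast
  qed
  show "cell ?D T s' < cell ?D T s" if down: "\<not> (c < c' \<or> c = c' \<and> even ?r)"
  proof (cases "?r = ?r'")
    case True
    then have "odd ?r" using down unfolding c_def c'_def by auto
    then show ?thesis using True lt t' unfolding cell_def by simp
  next
    case False
    then have "?r' < ?r" using down pairs(2) unfolding c_def c'_def by blast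
    then show ?thesis using cell_less_if_row_less s assms(2) by blast
  qed
qed

lemma hard_request_bounds:
  assumes "D > 0" "T > 0" "q < (D * T) ^ h"
  shows "0 \<le> hard_request D T h q" "hard_request D T h q < 1"
proof -
  have "0 \<le> hard_request D T h q \<and> hard_request D T h q < 1"
    using assms(3)
  proof (induction h arbitrary: q)
    case (Suc h)
    let ?s = "q div (D * T) ^ h" and ?q = "q mod (D * T) ^ h"
    have pos: "(D * T) ^ h > 0" using assms by simp
    have s: "?s < D * T" using Suc.prems by (simp add: less_mult_imp_div_less)
    have "cell D T ?s + 1 \<le> 2 * D * T" using cell_less[OF s] by simp
    then have "real (cell D T ?s + 1) \<le> real (2 * D * T)" by (simp only: of_nat_le_iff)
    then have c: "real (cell D T ?s) + 1 \<le> real (2 * D * T)" by simp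
    have IH: "0 \<le> hard_request D T h ?q" "hard_request D T h ?q < 1"
      using Suc.IH[of ?q] pos by simp_all
    have "real (cell D T ?s) + hard_request D T h ?q < real (2 * D * T)"
      using IH c by linarith
    then show ?case using IH assms by (simp add: divide_less_eq)
  qed simp
  then show "0 \<le> hard_request D T h q" "hard_request D T h q < 1" by simp_all
qed

lemma hard_request_block:
  assumes "q < (D * T) ^ h"
  shows "hard_request D T (Suc h) (s * (D * T) ^ h + q) =
    (real (cell D T s) + hard_request D T h q) / real (2 * D * T)"
proof -
  have "(s * m + q) div m = s \<and> (s * m + q) mod m = q" if "q < m" for m :: nat
    using that by simp
  then show ?thesis using assms by (simp only: hard_request.simps)
qed

lemma hard_request_less:
  assumes "D > 0" "T > 0" "s < D * T" "s' < D * T" "q < (D * T) ^ h" "q' < (D * T) ^ h"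
    "cell D T s < cell D T s'"
  shows "hard_request D T (Suc h) (s * (D * T) ^ h + q) < hard_request D T (Suc h) (s' * (D * T) ^ h + q')"
proof -
  have "real (cell D T s) + 1 \<le> real (cell D T s')" using assms(7) by linarith
  then have "real (cell D T s) + hard_request D T h q < real (cell D T s') + hard_request D T h q'"
    using hard_request_bounds[OF assms(1,2,5)] hard_request_bounds[OF assms(1,2,6)] by linarith
  then have "(real (cell D T s) + hard_request D T h q) / real (2 * D * T)
      < (real (cell D T s') + hard_request D T h q') / real (2 * D * T)"
    using assms(1,2) by (intro divide_strict_right_mono) auto
  then show ?thesis by (simp only: hard_request_block[OF assms(5)] hard_request_block[OF assms(6)])
qed

lemma nat_block_image: "(\<lambda>q. s * m + q) ` {..<m} = {s * m..<Suc s * m}" for m :: nat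
  using image_add_atLeastLessThan[of "s * m" 0 m] by (simp add: lessThan_atLeast0 add.commute)

lemma nat_block_UN: "(\<Union>s<N. {s * m..<Suc s * m}) = {..<N * m}" for m :: nat
  by (induction N) (auto simp: lessThan_Suc)

text \<open>The visits are the blocks of \<open>collapsible_blocks\<close>, coloured by the
  \<open>d\<close> pairs of rows. Each visit is a scaled copy of the lower level, so the induction
  hypothesis collapses it.\<close>

lemma collapsible_hard_request:
  assumes "d > 0" "T > 0"
  shows "collapsible (homog (\<lambda>i. i) (hard_request (2 * d) T h)) d (singletons {..<(2 * d * T) ^ h}) \<and>
    inj_on (hard_request (2 * d) T h) {..<(2 * d * T) ^ h}"
proof (induction h)
  case 0
  show ?case using assms collapsible_card_le[of "{{0}}" d] by (simp add: lessThan_Suc)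
next
  case (Suc h)
  let ?D = "2 * d"
  let ?N = "?D * T"
  let ?f = "hard_request ?D T (Suc h)"
  define m where "m = ?N ^ h"
  define B where "B s = {s * m..<Suc s * m}" for s
  define col where "col s = s mod ?D div 2" for s
  have D: "?D > 0" using assms by simp
  have m: "m > 0" unfolding m_def using assms by simp
  have UN: "(\<Union>s<?N. B s) = {..<?N ^ Suc h}"
    unfolding B_def nat_block_UN m_def by simp
  have less: "?f i < ?f j" if ss': "s < ?N" "s' < ?N" "i \<in> B s" "j \<in> B s'" "cell ?D T s < cell ?D T s'" for s s' i j
  proof -
    obtain q where q: "i = s * m + q" "q < m" using ss'(3) unfolding B_def nat_block_image[symmetric] by blast
    obtain q' where q': "j = s' * m + q'" "q' < m" using ss'(4) unfolding B_def nat_block_image[symmetric] by blast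
    show ?thesis using hard_request_less[OF D assms(2) ss'(1,2) _ _ ss'(5)] q q' unfolding m_def by simp
  qed
  have cell_neq: "cell ?D T s \<noteq> cell ?D T s'" if "s < s'" "s' < ?N" for s s'
    using cell_order[OF that] less_irrefl[of "cell ?D T s"] by metis
  have eq: "?f (s * m + q) = (real (cell ?D T s) + hard_request ?D T h q) / real (2 * ?D * T)" if "q < m" for s q
    using that unfolding m_def by (rule hard_request_block)
  have inj: "inj_on ?f {..<?N ^ Suc h}"
  proof (rule inj_onI)
    fix i j assume ij: "i \<in> {..<?N ^ Suc h}" "j \<in> {..<?N ^ Suc h}" "?f i = ?f j"
    obtain s s' where s: "s < ?N" "i \<in> B s" "s' < ?N" "j \<in> B s'" using ij(1,2) UN by blast
    \<comment> \<open>Distinct visits use distinct cells; equal requests therefore belong to the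
      same visit, where the lower level decides.\<close>
    have "s = s'"
      using s less[of s s' i j] less[of s' s j i] ij(3) cell_neq[of s s'] cell_neq[of s' s]
      by (metis less_irrefl linorder_neqE_nat)
    obtain q where q: "i = s * m + q" "q < m" using s(2) unfolding B_def nat_block_image[symmetric] by blast
    obtain q' where q': "j = s * m + q'" "q' < m"
      using s(4) \<open>s = s'\<close> unfolding B_def nat_block_image[symmetric] by blast
    have "hard_request ?D T h q = hard_request ?D T h q'"
      using ij(3) assms unfolding q(1) q'(1) eq[OF q(2)] eq[OF q'(2)] by simp
    then show "i = j" using Suc.IH q q' inj_onD[of "hard_request ?D T h" "{..<m}" q q'] unfolding m_def by simp
  qed
  have "collapsible (homog (\<lambda>i. i) ?f) d (singletons (\<Union>s<?N. B s))"
  proof (rule collapsible_blocks[where col = col])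
    show "?N > 0" "d > 0" using assms by simp_all
    show "finite (B s)" "B s \<noteq> {}" for s unfolding B_def using m by auto
    show "col s < d" for s
    proof -
      have "s mod ?D < ?D" using D by simp
      then show ?thesis unfolding col_def by linarith
    qed
    show "inj_on (\<lambda>i. i) (\<Union>s<?N. B s)" by simp
    show "inj_on ?f (\<Union>s<?N. B s)" using inj UN by simp
    show "i < j" if "s < s'" "i \<in> B s" "j \<in> B s'" for s s' i j
    proof -
      have "Suc s * m \<le> s' * m" using that(1) by (intro mult_le_mono1) simp
      then show ?thesis using that unfolding B_def by simp
    qed
    show "collapsible (homog (\<lambda>i. i) ?f) d (singletons (B s))" for s
      unfolding B_def nat_block_image[symmetric]
    proof (rule collapsible_singletons_image)
      show "collapsible (homog (\<lambda>i. i) (hard_request ?D T h)) d (singletons {..<m})"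
        using Suc.IH unfolding m_def by simp
      show "inj_on (\<lambda>q. s * m + q) {..<m}" by simp
      show "?f (s * m + i) < ?f (s * m + j)"
        if "i \<in> {..<m}" "j \<in> {..<m}" "hard_request ?D T h i < hard_request ?D T h j" for i j
        using that eq[of i s] eq[of j s] assms
        by (simp add: divide_strict_right_mono del: hard_request.simps)
    qed simp
    \<comment> \<open>By \<open>cell_order\<close> all later blocks of colour \<open>c\<close> lie
      on the same side of block \<open>s\<close>.\<close>
    show "separated ?f (B s) (\<Union> (B ` {s'. s < s' \<and> s' < ?N \<and> col s' = c}))" if "s < ?N" for s c
    proof (cases "col s < c \<or> col s = c \<and> even (s mod ?D)")
      case True
      have "?f i < ?f j" if "i \<in> B s" "j \<in> B s'" "s < s'" "s' < ?N" "col s' = c" for i j s'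
        using that True \<open>s < ?N\<close> cell_order(1)[OF that(3,4)] by (intro less[of s s']) (auto simp: col_def)
      then show ?thesis unfolding separated_def by blast
    next
      case False
      have "?f j < ?f i" if "i \<in> B s" "j \<in> B s'" "s < s'" "s' < ?N" "col s' = c" for i j s'
        using that False \<open>s < ?N\<close> cell_order(2)[OF that(3,4)] by (intro less[of s' s]) (auto simp: col_def)
      then show ?thesis unfolding separated_def by blast
    qed
  qed
  with inj show ?case unfolding UN by blast
qed

section \<open>The cost of serving the hard requests\<close>

lemma abs_diff_le_sum_steps:
  fixes f :: "nat \<Rightarrow> real"
  assumes "a \<le> b"
  shows "\<bar>f b - f a\<bar> \<le> (\<Sum>i\<in>{a<..b}. \<bar>f i - f (i - 1)\<bar>)"
  using assms
proof (induction rule: dec_induct)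
  case (step n)
  then have "{a<..Suc n} = insert (Suc n) {a<..n}" by auto
  then show ?case using step by simp
qed simp

lemma sum_consecutive_blocks:
  fixes g :: "nat \<Rightarrow> real"
  shows "(\<Sum>i\<in>{a..<a + T * m}. g i) = (\<Sum>t<T. \<Sum>i\<in>{a + t * m..<a + t * m + m}. g i)"
proof (induction T)
  case (Suc T)
  have "{a..<a + Suc T * m} = {a..<a + T * m} \<union> {a + T * m..<a + T * m + m}" by auto
  then show ?case using Suc by (simp add: sum.union_disjoint)
qed simp

text \<open>In each of the \<open>T\<close> rounds either some server moves from one row to another, at distance at
  least \<open>1 / (2 * D)\<close>, or the servers split among the \<open>D\<close> rows and some row gets fewer than
  \<open>D ^ (h - 1)\<close> of them.\<close>

lemma hard_request_cost:
  fixes p :: "nat \<Rightarrow> 'j \<Rightarrow> real"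
  assumes "D > 0" "T > 0" "\<beta> > 0" "finite J" "card J < D ^ h"
    and "\<And>q. q < (D * T) ^ h \<Longrightarrow> \<exists>j\<in>J. p (a + q) j = \<alpha> + \<beta> * hard_request D T h q"
  shows "\<beta> * real T / real (2 * D) ^ h \<le> (\<Sum>i\<in>{a..<a + (D * T) ^ h}. \<Sum>j\<in>J. \<bar>p i j - p (i - 1) j\<bar>)"
  using assms(3-6)
proof (induction h arbitrary: a \<alpha> \<beta> J)
  case 0
  \<comment> \<open>Without servers the only request is not served, so the hypotheses are
    contradictory.\<close>
  then have "J = {}" by simp
  then show ?case using 0(4)[of 0] by simp
next
  case (Suc h)
  define m where "m = (D * T) ^ h"
  define g where "g i = (\<Sum>j\<in>J. \<bar>p i j - p (i - 1) j\<bar>)" for i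
  have g_nonneg: "g i \<ge> 0" for i unfolding g_def by (intro sum_nonneg) simp
  have m: "m > 0" unfolding m_def using assms by simp
  have D1: "real (2 * D) \<ge> 1" using assms(1) by simp
  \<comment> \<open>A change of rows costs at least \<open>\<beta> / (2 * D)\<close>, which already
    exceeds or equals the share of one round.\<close>
  have "real (2 * D) ^ h \<ge> 1" using one_le_power[OF D1] .
  then have weak: "\<beta> / real (2 * D) ^ Suc h \<le> \<beta> / real (2 * D)"
    using Suc.prems(1) assms(1) by (intro divide_left_mono) auto
  \<comment> \<open>Each round pays the \<open>T\<close>-th part of the bound. In the inductive case
    the factor \<open>T\<close> won inside one visit cancels the \<open>1 / T\<close> of the
    scaling.\<close>
  have round: "\<beta> / real (2 * D) ^ Suc h \<le> (\<Sum>i\<in>{a + t * (D * m)..<a + t * (D * m) + D * m}. g i)"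
    if t: "t < T" for t
  proof -
    define b where "b = a + t * (D * m)"
    define time where "time r q = b + r * m + q" for r q
    define y where "y r q = (real (cell D T (t * D + r)) + hard_request D T h q) / real (2 * D * T)" for r q
    have block_less: "t * D + r < D * T" if "r < D" for r
    proof -
      have "t * D + r < Suc t * D" using that by simp
      also have "\<dots> \<le> T * D" using t by (intro mult_le_mono1) simp
      finally show ?thesis by (simp add: mult.commute)
    qed
    have served: "\<exists>j\<in>J. p (time r q) j = \<alpha> + \<beta> * y r q" if "r < D" "q < m" for r q
    proof -
      have "(t * D + r) * m + q < Suc (t * D + r) * m" using that(2) by simp
      also have "\<dots> \<le> (D * T) * m" using block_less[OF that(1)] by (intro mult_le_mono1) simp
      finally have "(t * D + r) * m + q < (D * T) ^ Suc h" unfolding m_def by simp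
      from Suc.prems(4)[OF this] have "\<exists>j\<in>J. p (a + ((t * D + r) * m + q)) j = \<alpha> + \<beta> * y r q"
        unfolding m_def y_def hard_request_block[OF that(2)[unfolded m_def]] .
      moreover have "a + ((t * D + r) * m + q) = time r q"
        unfolding time_def b_def by (simp add: algebra_simps)
      ultimately show ?thesis by simp
    qed
    have window: "time r q < b + D * m" if "r < D" "q < m" for r q
    proof -
      have "r * m + q < Suc r * m" using that(2) by simp
      also have "\<dots> \<le> D * m" using that(1) by (intro mult_le_mono1) simp
      finally show ?thesis unfolding time_def by simp
    qed
    have gap: "y r q + 1 / real (2 * D) \<le> y r' q'" if "r < r'" "r' < D" "q < m" "q' < m" for r r' q q'
    proof -
      have rD: "r < D" using that by simp
      have "2 * T * Suc r \<le> 2 * T * r'" using that(1) by (intro mult_le_mono2) simp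
      then have "cell D T (t * D + r) + 1 + T \<le> cell D T (t * D + r')"
        using cell_row(2)[OF block_less[OF rD]] cell_row(1)[OF block_less[OF that(2)]] that(2) rD by simp
      then have "real (cell D T (t * D + r) + 1 + T) \<le> real (cell D T (t * D + r'))"
        by (simp only: of_nat_le_iff)
      then have "real (cell D T (t * D + r)) + hard_request D T h q + T
          \<le> real (cell D T (t * D + r')) + hard_request D T h q'"
        using hard_request_bounds[OF assms(1,2), of q h] hard_request_bounds[OF assms(1,2), of q' h]
          that(3,4) unfolding m_def by simp
      then have "(real (cell D T (t * D + r)) + hard_request D T h q + T) / real (2 * D * T) \<le> y r' q'"
        unfolding y_def by (intro divide_right_mono) auto
      moreover have "real T / real (2 * D * T) = 1 / real (2 * D)" using assms(2) by simp
      ultimately show ?thesis unfolding y_def add_divide_distrib by simp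
    qed
    \<comment> \<open>\<open>S r\<close> consists of the servers used during this round's visit to
      row \<open>r\<close>. A server in two of these sets crosses a gap.\<close>
    define S where "S r = {j \<in> J. \<exists>q<m. p (time r q) j = \<alpha> + \<beta> * y r q}" for r
    show ?thesis
    proof (cases "\<exists>r<D. \<exists>r'<D. r < r' \<and> S r \<inter> S r' \<noteq> {}")
      case True
      then obtain r r' j where r: "r < r'" "r' < D" "j \<in> S r" "j \<in> S r'" by blast
      then obtain q q' where q: "q < m" "q' < m" "j \<in> J"
        "p (time r q) j = \<alpha> + \<beta> * y r q" "p (time r' q') j = \<alpha> + \<beta> * y r' q'"
        unfolding S_def by blast
      have "\<beta> * (y r q + 1 / real (2 * D)) \<le> \<beta> * y r' q'"
        using gap[OF r(1,2) q(1,2)] Suc.prems(1) by simp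
      then have far: "\<beta> / real (2 * D) \<le> \<bar>p (time r' q') j - p (time r q) j\<bar>"
        unfolding q(4,5) by (simp add: algebra_simps)
      have order: "time r q \<le> time r' q'"
      proof -
        have "Suc r * m \<le> r' * m" using r(1) by (intro mult_le_mono1) simp
        then show ?thesis unfolding time_def using q(1) by simp
      qed
      have "\<beta> / real (2 * D) \<le> (\<Sum>i\<in>{time r q<..time r' q'}. \<bar>p i j - p (i - 1) j\<bar>)"
        using far abs_diff_le_sum_steps[OF order, of "\<lambda>i. p i j"] by linarith
      also have "\<dots> \<le> (\<Sum>i\<in>{time r q<..time r' q'}. g i)"
        unfolding g_def using q(3) Suc.prems(2)
        by (intro sum_mono member_le_sum[where f = "\<lambda>j. \<bar>p _ j - p (_ - 1) j\<bar>"]) auto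
      also have "\<dots> \<le> (\<Sum>i\<in>{b..<b + D * m}. g i)"
        using g_nonneg window[OF r(2) q(2)] by (intro sum_mono2) (auto simp: time_def)
      finally show ?thesis using weak unfolding b_def by linarith
    next
      case False
      then have disj: "S r \<inter> S r' = {}" if "r < D" "r' < D" "r \<noteq> r'" for r r'
        using that by (metis Int_commute linorder_neqE_nat)
      \<comment> \<open>Pigeonhole: \<open>D\<close> disjoint sets with at least
        \<open>D ^ h\<close> servers each would need \<open>D ^ Suc h\<close> servers.\<close>
      have "\<exists>r<D. card (S r) < D ^ h"
      proof (rule ccontr)
        assume "\<not> ?thesis"
        then have "D ^ h \<le> card (S r)" if "r < D" for r using that by (meson not_less)
        then have "(\<Sum>r<D. D ^ h) \<le> (\<Sum>r<D. card (S r))" by (intro sum_mono) simp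
        also have "\<dots> = card (\<Union>r<D. S r)"
          using disj Suc.prems(2) by (intro card_UN_disjoint[symmetric]) (auto simp: S_def)
        also have "\<dots> \<le> card J" using Suc.prems(2) by (intro card_mono) (auto simp: S_def)
        finally show False using Suc.prems(3) by simp
      qed
      then obtain r where r: "r < D" "card (S r) < D ^ h" by blast
      define \<alpha>' where "\<alpha>' = \<alpha> + \<beta> * real (cell D T (t * D + r)) / real (2 * D * T)"
      define \<beta>' where "\<beta>' = \<beta> / real (2 * D * T)"
      \<comment> \<open>The induction hypothesis is used for the servers in \<open>S r\<close>
        alone: they serve the whole visit, and the moves of the others cost at least 0.\<close>
      have "\<beta>' * real T / real (2 * D) ^ h
          \<le> (\<Sum>i\<in>{b + r * m..<b + r * m + (D * T) ^ h}. \<Sum>j\<in>S r. \<bar>p i j - p (i - 1) j\<bar>)"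
      proof (rule Suc.IH[where \<alpha> = \<alpha>'])
        show "\<beta>' > 0" unfolding \<beta>'_def using Suc.prems(1) assms by simp
        show "finite (S r)" unfolding S_def using Suc.prems(2) by simp
        show "card (S r) < D ^ h" by (fact r(2))
        fix q assume q: "q < (D * T) ^ h"
        have "\<exists>j\<in>S r. p (time r q) j = \<alpha> + \<beta> * y r q"
          using served[OF r(1), of q] q unfolding S_def m_def by blast
        moreover have "\<alpha> + \<beta> * y r q = \<alpha>' + \<beta>' * hard_request D T h q"
          unfolding \<alpha>'_def \<beta>'_def y_def by (simp add: add_divide_distrib distrib_left)
        ultimately show "\<exists>j\<in>S r. p (b + r * m + q) j = \<alpha>' + \<beta>' * hard_request D T h q"
          unfolding time_def by simp
      qed
      also have "\<dots> \<le> (\<Sum>i\<in>{b + r * m..<b + r * m + m}. g i)"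
        unfolding g_def m_def[symmetric] using Suc.prems(2)
        by (intro sum_mono sum_mono2) (auto simp: S_def)
      also have "\<dots> \<le> (\<Sum>i\<in>{b..<b + D * m}. g i)"
      proof (intro sum_mono2)
        have "Suc r * m \<le> D * m" using r(1) by (intro mult_le_mono1) simp
        then show "{b + r * m..<b + r * m + m} \<subseteq> {b..<b + D * m}" by auto
      qed (use g_nonneg in auto)
      also have "\<beta>' * real T / real (2 * D) ^ h = \<beta> / real (2 * D) ^ Suc h"
        unfolding \<beta>'_def using assms(1,2) by simp
      finally show ?thesis unfolding b_def .
    qed
  qed
  have "real T * (\<beta> / real (2 * D) ^ Suc h) \<le>
      (\<Sum>t<T. \<Sum>i\<in>{a + t * (D * m)..<a + t * (D * m) + D * m}. g i)"
    using sum_mono[of "{..<T}" "\<lambda>_. \<beta> / real (2 * D) ^ Suc h", OF round] by simp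
  also have "\<dots> = (\<Sum>i\<in>{a..<a + T * (D * m)}. g i)" by (rule sum_consecutive_blocks[symmetric])
  also have "T * (D * m) = (D * T) ^ Suc h" unfolding m_def by (simp add: mult_ac)
  finally show ?case unfolding g_def by (simp add: mult_ac)
qed

section \<open>Lower bounds for the optimum\<close>

text \<open>The infimum is taken over a non-empty set: sending all servers to every request is a
  valid solution.\<close>

lemma OPT_greatest:
  assumes "k \<ge> 1" "set X \<subseteq> {0..1}" "\<And>p. valid_solution k X p \<Longrightarrow> c \<le> solution_cost k X p"
  shows "c \<le> OPT k X"
  unfolding OPT_def
proof (rule cInf_greatest)
  have "valid_solution k X (\<lambda>i j. if i = 0 then 0 else X ! (i - 1))"
    unfolding valid_solution_def using assms(1) subsetD[OF assms(2) nth_mem] by force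
  then show "{solution_cost k X p |p. valid_solution k X p} \<noteq> {}" by blast
qed (use assms(3) in blast)

text \<open>All servers start at 0, so the one at the first request has travelled
  \<open>X ! 0\<close>. This settles the cases in which the desired bound is at most a
  constant.\<close>

lemma OPT_ge_first_request:
  assumes "k \<ge> 1" "set X \<subseteq> {0..1}" "X \<noteq> []"
  shows "X ! 0 \<le> OPT k X"
proof (rule OPT_greatest[OF assms(1,2)])
  fix p assume p: "valid_solution k X p"
  have "1 \<in> {1..length X}" using assms(3) by (simp add: Suc_le_eq)
  then have "\<exists>j\<in>{1..k}. p 1 j = X ! (1 - 1)" using p unfolding valid_solution_def by blast
  then obtain j where j: "j \<in> {1..k}" "p 1 j = X ! 0" by auto
  have "p 0 j = 0" using p j(1) unfolding valid_solution_def by blast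
  then have "X ! 0 \<le> \<bar>p 1 j - p (1 - 1) j\<bar>" using j(2) by simp
  also have "\<dots> \<le> (\<Sum>j=1..k. \<bar>p 1 j - p (1 - 1) j\<bar>)"
    using j(1) by (intro member_le_sum) auto
  also have "\<dots> \<le> solution_cost k X p"
    unfolding solution_cost_def using \<open>1 \<in> {1..length X}\<close>
    by (intro member_le_sum[where f = "\<lambda>i. \<Sum>j=1..k. \<bar>p i j - p (i - 1) j\<bar>"]) (auto intro: sum_nonneg)
  finally show "X ! 0 \<le> solution_cost k X p" .
qed

lemma OPT_ge_hard_prefix:
  assumes "k \<ge> 1" "set X \<subseteq> {0..1}" "D > 0" "T > 0" "\<beta> > 0" "k < D ^ h" "(D * T) ^ h \<le> length X"
    and "\<And>q. q < (D * T) ^ h \<Longrightarrow> X ! q = \<beta> * hard_request D T h q"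
  shows "\<beta> * real T / real (2 * D) ^ h \<le> OPT k X"
proof (rule OPT_greatest[OF assms(1,2)])
  fix p assume p: "valid_solution k X p"
  let ?g = "\<lambda>i. \<Sum>j=1..k. \<bar>p i j - p (i - 1) j\<bar>"
  \<comment> \<open>Entry \<open>q\<close> of the list is served at time \<open>1 + q\<close>, hence
    the range starts at 1.\<close>
  have "\<beta> * real T / real (2 * D) ^ h \<le> (\<Sum>i\<in>{1..<1 + (D * T) ^ h}. ?g i)"
  proof (rule hard_request_cost[where \<alpha> = 0])
    fix q assume q: "q < (D * T) ^ h"
    then have "1 + q \<in> {1..length X}" using assms(7) by simp
    then have "\<exists>j\<in>{1..k}. p (1 + q) j = X ! (1 + q - 1)"
      using p unfolding valid_solution_def by blast
    then show "\<exists>j\<in>{1..k}. p (1 + q) j = 0 + \<beta> * hard_request D T h q"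
      using assms(8)[OF q] by simp
  qed (use assms in auto)
  also have "\<dots> \<le> (\<Sum>i=1..length X. ?g i)"
    using assms(7) by (intro sum_mono2) (auto intro: sum_nonneg)
  finally show "\<beta> * real T / real (2 * D) ^ h \<le> solution_cost k X p"
    unfolding solution_cost_def .
qed

section \<open>Inputs of prescribed twin-width\<close>

text \<open>Halving the hard requests leaves the upper half of the unit interval to an increasing
  tail. For \<open>T = 0\<close> and positive \<open>h\<close> there is no hard part, and the
  requests increase from \<open>1 / 2\<close> on.\<close>

definition padded_request :: "nat \<Rightarrow> nat \<Rightarrow> nat \<Rightarrow> nat \<Rightarrow> nat \<Rightarrow> real" where
  "padded_request n D T h q =
     (if q < (D * T) ^ h then hard_request D T h q / 2 else 1 / 2 + real q / real (2 * n))"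

lemma padded_request_mem:
  assumes "D > 0" "q < n"
  shows "padded_request n D T h q \<in> {0..1}"
proof (cases "q < (D * T) ^ h \<and> T > 0")
  case True
  then show ?thesis using hard_request_bounds[OF assms(1), of T q h] by (simp add: padded_request_def)
next
  case False
  show ?thesis
  proof (cases "q < (D * T) ^ h")
    case True
    \<comment> \<open>Here \<open>T = 0\<close>, and \<open>(D * 0) ^ 0 = 1\<close> leaves the
      single request 0 of level 0.\<close>
    then have "h = 0" using False by (cases h) auto
    then show ?thesis using True by (simp add: padded_request_def)
  next
    case False
    have "real q / real (2 * n) \<le> 1 / 2" using assms(2) by (simp add: field_simps)
    then show ?thesis using False by (simp add: padded_request_def)
  qed
qed

text \<open>The hard part lies below \<open>1 / 2\<close> and the tail increases from there, so
  \<open>collapsible_increasing_tail\<close> applies. Positive \<open>h\<close> makes the hard part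
  empty when \<open>T = 0\<close>.\<close>

lemma collapsible_padded_request:
  assumes "d > 0" "n > 0" "h > 0" "(2 * d * T) ^ h \<le> n"
  shows "collapsible (homog (\<lambda>i. i) (padded_request n (2 * d) T h)) d (singletons {..<n}) \<and>
    inj_on (padded_request n (2 * d) T h) {..<n}"
proof (rule collapsible_increasing_tail[of "(2 * d * T) ^ h"])
  let ?f = "padded_request n (2 * d) T h"
  let ?m = "(2 * d * T) ^ h"
  have T: "T > 0" if "?m > 0" using that assms(3) by (cases T) auto
  show "collapsible (homog (\<lambda>i. i) ?f) d (singletons {..<?m})" if "?m > 0"
    using collapsible_singletons_image[of "\<lambda>i. i" "hard_request (2 * d) T h" d "{..<?m}" "\<lambda>i. i" "\<lambda>i. i" ?f]
      collapsible_hard_request[OF assms(1) T[OF that], of h]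
    by (simp add: padded_request_def)
  show "inj_on ?f {..<?m}"
  proof (cases "?m > 0")
    case True
    then show ?thesis
      using collapsible_hard_request[OF assms(1) T[OF True], of h]
      unfolding inj_on_def by (simp add: padded_request_def)
  next
    case False
    then have "{..<?m} = {}" by (metis lessThan_0 neq0_conv)
    then show ?thesis by (simp only: inj_on_empty)
  qed
  show "?f i < ?f j" if "i < j" "?m \<le> j" "j < n" for i j
  proof (cases "i < ?m")
    case True
    have "T > 0" by (rule T[OF le_less_trans[OF le0 True]])
    then have "?f i < 1 / 2"
      using True hard_request_bounds(2)[of "2 * d" T i h] assms(1) by (simp add: padded_request_def)
    also have "\<dots> \<le> ?f j" using that by (simp add: padded_request_def)
    finally show ?thesis .
  next
    case False
    then show ?thesis using that assms(2) by (simp add: padded_request_def divide_strict_right_mono)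
  qed
qed (use assms in auto)

text \<open>Only the last \<open>(d + 1) * (d + 1)\<close> entries are permuted. In increasing order
  width \<open>d\<close> suffices; as a transposed grid of side \<open>d + 1\<close> they rule out
  width \<open>d - 1\<close>. Between the two lies an order of twin-width exactly
  \<open>d\<close>.\<close>

lemma ex_exact_twin_width_with_prefix:
  fixes f :: "nat \<Rightarrow> real"
  assumes "collapsible (homog (\<lambda>i. i) f) d (singletons {..<n})" "inj_on f {..<n}" "d > 0"
    and "l + (d + 1) * (d + 1) = n" "\<And>i j. l \<le> i \<Longrightarrow> i < j \<Longrightarrow> j < n \<Longrightarrow> f i < f j"
  shows "\<exists>ys. mset ys = mset (map f [l..<n]) \<and> seq_twin_width (map f [0..<l] @ ys) = d"
proof -
  let ?q = "d + 1"
  let ?P = "map f [0..<l]"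
  define w where "w a = f (l + a)" for a
  have tail: "map w [0..<?q * ?q] = map f [l..<n]"
  proof -
    have "[l..<n] = map (\<lambda>a. a + l) [0..<?q * ?q]"
      unfolding assms(4)[symmetric] map_add_upt by (simp only: add.commute)
    then show ?thesis unfolding w_def by (simp add: comp_def add.commute)
  qed
  have whole: "?P @ map w [0..<?q * ?q] = map f [0..<n]"
    unfolding tail assms(4)[symmetric] using upt_add_eq_append[of 0 l "?q * ?q"] by (simp only: map_append le0)
  have "collapsible_list d (?P @ map w [0..<?q * ?q])"
    unfolding whole using assms(1) by (rule collapsible_list_map_upt)
  moreover have "\<not> collapsible_list (d - 1) (?P @ map (\<lambda>a. w (transpose_index ?q a)) [0..<?q * ?q])"
  proof -
    have "w i < w j" if "i < j" "j < ?q * ?q" for i j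
      using assms(5)[of "l + i" "l + j"] assms(4) that unfolding w_def by simp
    from not_collapsible_grid[of ?q w, OF this] show ?thesis using assms(3) by simp
  qed
  moreover have "adjacent_swap\<^sup>*\<^sup>* (map w [0..<?q * ?q]) (map (\<lambda>a. w (transpose_index ?q a)) [0..<?q * ?q])"
    by (rule adjacent_swaps_if_mset_eq) (rule mset_map_transpose_index[symmetric])
  ultimately obtain ys where ys: "mset ys = mset (map w [0..<?q * ?q])" "collapsible_list d (?P @ ys)"
    "\<not> collapsible_list (d - 1) (?P @ ys)"
    using intermediate_collapsible_list[OF _ _ _ assms(3)] by blast
  have "mset (?P @ ys) = mset (map f [0..<n])"
    using ys(1) unfolding whole[symmetric] by simp
  moreover have "distinct (map f [0..<n])"
    using assms(2) by (simp add: distinct_map lessThan_atLeast0)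
  ultimately have "distinct (?P @ ys)" by (metis mset_eq_imp_distinct_iff)
  moreover have "?P @ ys \<noteq> []"
    using ys(1) by auto
  ultimately have "seq_twin_width (?P @ ys) = d"
    using ys(2,3) by (intro seq_twin_width_eqI)
  then show ?thesis using ys(1) unfolding tail by blast
qed

text \<open>For small \<open>n\<close> the value \<open>d\<close> may not be attained at all, hence
  the conditional form. If it is attained, the increasing map \<open>(1 + y) / 2\<close> lifts an
  input to the upper half and keeps its twin-width; otherwise an increasing input of twin-width at
  most 1 serves.\<close>

lemma ex_high_input:
  assumes "n \<ge> 1" "d \<ge> 1"
  shows "\<exists>X \<in> distinct_inputs n. seq_twin_width X \<le> d \<and>
    ((\<exists>Y \<in> distinct_inputs n. seq_twin_width Y = d) \<longrightarrow> seq_twin_width X = d) \<and> X ! 0 \<ge> 1 / 2"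
proof (cases "\<exists>Y \<in> distinct_inputs n. seq_twin_width Y = d")
  case True
  then obtain Y where Y: "length Y = n" "distinct Y" "set Y \<subseteq> {0..1}" "seq_twin_width Y = d"
    unfolding distinct_inputs_def by blast
  let ?X = "map (\<lambda>y. (1 + y) / 2) Y"
  have dist: "distinct ?X" using Y(2) by (simp add: distinct_map inj_on_def)
  have "?X \<noteq> []" "Y \<noteq> []" using Y(1) assms(1) by auto
  have "collapsible_list e ?X \<longleftrightarrow> collapsible_list e Y" for e
    by (auto intro: collapsible_list_transfer[of e Y ?X] collapsible_list_transfer[of e ?X Y])
  then have "seq_twin_width ?X = d"
    using Y(4) seq_twin_width_eq[OF dist \<open>?X \<noteq> []\<close>] seq_twin_width_eq[OF Y(2) \<open>Y \<noteq> []\<close>] by simp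
  moreover have "?X \<in> distinct_inputs n"
    using Y dist unfolding distinct_inputs_def by fastforce
  moreover have "?X ! 0 \<ge> 1 / 2"
    using Y(3) nth_mem[of 0 Y] \<open>Y \<noteq> []\<close> by fastforce
  ultimately show ?thesis by (intro bexI[of _ ?X]) auto
next
  case False
  \<comment> \<open>The choice \<open>T = 0\<close> on level 1 gives the purely increasing
    requests.\<close>
  let ?f = "padded_request n (2 * 1) 0 1"
  have f: "collapsible (homog (\<lambda>i. i) ?f) 1 (singletons {..<n}) \<and> inj_on ?f {..<n}"
    using assms by (intro collapsible_padded_request) auto
  let ?X = "map ?f [0..<n]"
  have dist: "distinct ?X" using f by (simp add: distinct_map lessThan_atLeast0)
  have "seq_twin_width ?X \<le> 1"
    using f dist assms(1) by (intro seq_twin_width_le collapsible_list_map_upt) auto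
  moreover have "?X \<in> distinct_inputs n"
    using dist padded_request_mem[of 2] unfolding distinct_inputs_def by auto
  moreover have "?X ! 0 \<ge> 1 / 2" using assms(1) by (simp add: padded_request_def)
  ultimately show ?thesis using False assms(2) by (intro bexI[of _ ?X]) auto
qed

section \<open>Choice of the parameters and the final estimate\<close>

lemma floor_log_bounds:
  assumes "k \<ge> 1" "b \<ge> 2"
  obtains h where "\<lfloor>log (real b) (real k)\<rfloor> = int h" "b ^ h \<le> k" "k < b ^ Suc h"
proof
  let ?L = "\<lfloor>log (real b) (real k)\<rfloor>"
  have "?L \<ge> 0" using assms by simp
  then show L: "?L = int (nat ?L)" by simp
  have "real b powr real_of_int ?L \<le> real k \<and> real k < real b powr (real_of_int ?L + 1)"
    using assms floor_log_eq_powr_iff[of "real k" "real b" ?L] by simp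
  then have "real b ^ nat ?L \<le> real k" "real k < real b ^ Suc (nat ?L)"
    using L assms by (metis of_int_of_nat_eq of_nat_0_less_iff order.strict_trans2 powr_realpow zero_less_numeral,
      metis L of_int_of_nat_eq of_nat_Suc of_nat_0_less_iff order.strict_trans2 powr_realpow zero_less_numeral add.commute)
  then show "b ^ nat ?L \<le> k" "k < b ^ Suc (nat ?L)"
    by (metis of_nat_le_iff of_nat_power, metis of_nat_less_iff of_nat_power)
qed

text \<open>\<open>l\<close> entries remain in front of the \<open>(d + 1) * (d + 1)\<close>
  permuted ones, and \<open>T\<close> is the largest number of rounds for which the hard requests of
  level \<open>Suc h\<close> fit into them.\<close>

lemma ex_hard_input:
  assumes "d \<ge> 1" "k \<ge> 1" "8 * d\<^sup>2 \<le> n" "(2 * d) ^ h \<le> k" "k < (2 * d) ^ Suc h"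
  shows "\<exists>X \<in> distinct_inputs n. seq_twin_width X = d \<and>
    1 / 64 * (1 / real d ^ 2) * (1 / real k ^ 3) * real n powr (1 / real (Suc h)) \<le> OPT k X"
proof -
  define l where "l = n - (d + 1) * (d + 1)"
  define y where "y = real l powr (1 / real (Suc h))"
  define T where "T = nat \<lfloor>y / real (2 * d)\<rfloor>"
  let ?m = "(2 * d * T) ^ Suc h"
  let ?f = "padded_request n (2 * d) T (Suc h)"
  \<comment> \<open>The permuted entries number at most \<open>4 * d\<^sup>2\<close>, hence at most
    half of \<open>n\<close>, so replacing \<open>n\<close> by \<open>l\<close> costs at most a
    factor 2 in the estimate.\<close>
  have "(d + 1) * (d + 1) \<le> (2 * d) * (2 * d)" using assms(1) by (intro mult_le_mono) auto
  then have l: "l + (d + 1) * (d + 1) = n" "n \<le> 2 * l"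
    using assms(3) unfolding l_def by (simp_all add: power2_eq_square)
  have n: "n > 0" using assms(1,3) by (cases n) auto
  then have "l > 0" using l by simp
  have y: "y > 0" "y ^ Suc h = real l"
    using \<open>l > 0\<close> unfolding y_def by (simp_all add: powr_realpow[symmetric] powr_powr del: power_Suc)
  have d: "real d > 0" using assms(1) by simp
  have "real T \<le> y / real (2 * d)" unfolding T_def using y(1) by simp
  then have "real (2 * d * T) \<le> y" using d by (simp add: field_simps)
  then have "real (2 * d * T) ^ Suc h \<le> y ^ Suc h" by (intro power_mono) simp_all
  then have m: "?m \<le> l" unfolding y(2) by (metis of_nat_le_iff of_nat_power)
  have f: "collapsible (homog (\<lambda>i. i) ?f) d (singletons {..<n}) \<and> inj_on ?f {..<n}"
    using assms(1) n m l by (intro collapsible_padded_request) auto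
  have incr: "?f i < ?f j" if "l \<le> i" "i < j" "j < n" for i j
    using that m n by (simp add: padded_request_def divide_strict_right_mono)
  obtain ys where ys: "mset ys = mset (map ?f [l..<n])" "seq_twin_width (map ?f [0..<l] @ ys) = d"
    using ex_exact_twin_width_with_prefix[OF conjunct1[OF f] conjunct2[OF f] _ l(1) incr] assms(1) by auto
  let ?X = "map ?f [0..<l] @ ys"
  have "[0..<n] = [0..<l] @ [l..<n]" using upt_add_eq_append[of 0 l "n - l"] l(1) by simp
  then have X: "mset ?X = mset (map ?f [0..<n])" using ys(1) by simp
  have "distinct (map ?f [0..<n])" using f by (simp add: distinct_map lessThan_atLeast0)
  then have "distinct ?X" using X by (metis mset_eq_imp_distinct_iff)
  moreover have "length ?X = n" using X by (metis length_map length_upt minus_nat.diff_0 size_mset)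
  moreover have set_X: "set ?X \<subseteq> {0..1}"
    using padded_request_mem[of "2 * d"] assms(1) mset_eq_setD[OF X] by auto
  ultimately have mem: "?X \<in> distinct_inputs n" unfolding distinct_inputs_def by blast
  have nth: "?X ! q = ?f q" if "q < l" for q using that by (simp add: nth_append)
  have ny: "real n powr (1 / real (Suc h)) \<le> 2 * y"
  proof -
    have "real n powr (1 / real (Suc h)) \<le> (2 * real l) powr (1 / real (Suc h))"
      using l(2) by (intro powr_mono2) auto
    also have "\<dots> = 2 powr (1 / real (Suc h)) * y" unfolding y_def by (simp add: powr_mult)
    also have "\<dots> \<le> 2 powr 1 * y" using y(1) by (intro mult_right_mono powr_mono) auto
    finally show ?thesis by simp
  qed
  have k3: "1 / real k ^ 3 \<le> 1" using one_le_power[of "real k" 3] assms(2) by simp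
  have "1 / 64 * (1 / real d ^ 2) * (1 / real k ^ 3) * real n powr (1 / real (Suc h)) \<le> OPT k ?X"
  proof (cases "T = 0")
    \<comment> \<open>No round fits, so the desired bound is at most \<open>1 / (16 * d)\<close>,
      while the first request is already at \<open>1 / 2\<close>.\<close>
    case True
    then have "y / real (2 * d) < 1" unfolding T_def by linarith
    then have "real n powr (1 / real (Suc h)) \<le> 4 * real d" using ny d by (simp add: field_simps)
    then have "1 / 64 * (1 / real d ^ 2) * (1 / real k ^ 3) * real n powr (1 / real (Suc h))
        \<le> 1 / 64 * (1 / real d ^ 2) * 1 * (4 * real d)"
      using k3 by (intro mult_mono) auto
    also have "\<dots> = 1 / (16 * real d)" using d by (simp add: power2_eq_square)
    also have "\<dots> \<le> 1 / 2" using assms(1) by (intro divide_left_mono) auto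
    also have "\<dots> \<le> ?X ! 0" using nth[OF \<open>l > 0\<close>] True by (simp add: padded_request_def)
    also have "\<dots> \<le> OPT k ?X"
      using OPT_ge_first_request[OF assms(2) set_X] \<open>l > 0\<close> by simp
    finally show ?thesis .
  next
    case False
    \<comment> \<open>With at least one round, rounding down loses at most a factor 2.\<close>
    then have T: "real T \<ge> 1" by simp
    have "y / real (2 * d) \<le> real T + 1" unfolding T_def by linarith
    then have "y / real (2 * d) \<le> 2 * real T" using T by linarith
    then have "real n powr (1 / real (Suc h)) \<le> 8 * real d * real T" using ny d by (simp add: field_simps)
    then have "1 / 64 * (1 / real d ^ 2) * (1 / real k ^ 3) * real n powr (1 / real (Suc h))
        \<le> 1 / 64 * (1 / real d ^ 2) * (1 / real k ^ 3) * (8 * real d * real T)"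
      by (intro mult_left_mono) auto
    also have "\<dots> = real T / (8 * real d) / real k ^ 3" using d by (simp add: power2_eq_square)
    also have "\<dots> \<le> real T / (8 * real d) / real (4 * d) ^ h"
    proof (intro divide_left_mono)
      \<comment> \<open>The base \<open>4 * d\<close> splits into 2 and \<open>2 * d\<close>; the
        \<open>h\<close>-th power of either is at most \<open>k\<close>.\<close>
      have "2 ^ h \<le> (2 * d) ^ h" using assms(1) by (intro power_mono) auto
      then have "2 ^ h \<le> k" using assms(4) by (rule order.trans)
      have "(4 * d) ^ h = 2 ^ h * (2 * d) ^ h" by (subst power_mult_distrib[symmetric]) simp
      also have "\<dots> \<le> k * k" using \<open>2 ^ h \<le> k\<close> assms(4) by (rule mult_le_mono)
      also have "\<dots> \<le> k ^ 3" using assms(2) by (simp add: power3_eq_cube)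
      finally show "real (4 * d) ^ h \<le> real k ^ 3" by (metis of_nat_le_iff of_nat_power)
    qed (use d assms(2) in auto)
    also have "\<dots> = 1 / 2 * real T / real (2 * (2 * d)) ^ Suc h" using d by simp
    also have "\<dots> \<le> OPT k ?X"
    proof (rule OPT_ge_hard_prefix[OF assms(2) set_X])
      show "?X ! q = 1 / 2 * hard_request (2 * d) T (Suc h) q" if "q < ?m" for q
        using nth[of q] that m by (simp add: padded_request_def)
    qed (use assms False m in auto)
    finally show ?thesis .
  qed
  then show ?thesis using mem ys(2) by blast
qed

theorem theorem3p11:
  "\<exists>c::real. c > 0 \<and>
     (\<forall>n k d :: nat. n \<ge> 1 \<longrightarrow> k \<ge> 1 \<longrightarrow> d \<ge> 1 \<longrightarrow>
        (\<exists>X \<in> distinct_inputs n.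
           seq_twin_width X \<le> d \<and>
           ((\<exists>Y \<in> distinct_inputs n. seq_twin_width Y = d) \<longrightarrow> seq_twin_width X = d) \<and>
           OPT k X \<ge> c * (1 / real d ^ 2) * (1 / real k ^ 3)
             * real n powr (1 / (of_int \<lfloor>log (2 * real d) (real k)\<rfloor> + 1))))"
proof (intro exI[of _ "1 / 64"] conjI allI impI)
  fix n k d :: nat
  assume nkd: "n \<ge> 1" "k \<ge> 1" "d \<ge> 1"
  obtain h where h: "\<lfloor>log (real (2 * d)) (real k)\<rfloor> = int h" "(2 * d) ^ h \<le> k" "k < (2 * d) ^ Suc h"
    using floor_log_bounds[of k "2 * d"] nkd by auto
  have exponent: "1 / (real_of_int \<lfloor>log (2 * real d) (real k)\<rfloor> + 1) = 1 / real (Suc h)"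
    using h(1) by (simp add: add.commute)
  show "\<exists>X \<in> distinct_inputs n. seq_twin_width X \<le> d \<and>
      ((\<exists>Y \<in> distinct_inputs n. seq_twin_width Y = d) \<longrightarrow> seq_twin_width X = d) \<and>
      1 / 64 * (1 / real d ^ 2) * (1 / real k ^ 3)
        * real n powr (1 / (real_of_int \<lfloor>log (2 * real d) (real k)\<rfloor> + 1)) \<le> OPT k X"
  proof (cases "8 * d\<^sup>2 \<le> n")
    case True
    from ex_hard_input[OF nkd(3,2) True h(2,3)] show ?thesis unfolding exponent by fastforce
  next
    case False
    obtain X where X: "X \<in> distinct_inputs n" "seq_twin_width X \<le> d"
      "(\<exists>Y \<in> distinct_inputs n. seq_twin_width Y = d) \<longrightarrow> seq_twin_width X = d" "X ! 0 \<ge> 1 / 2"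
      using ex_high_input[OF nkd(1,3)] by blast
    \<comment> \<open>For \<open>n < 8 * d\<^sup>2\<close> the exponent is replaced by 1; the
      desired bound is then at most \<open>1 / 8\<close>, and the first request at
      \<open>1 / 2\<close> or higher pays for it.\<close>
    have "real n powr (1 / real (Suc h)) \<le> real n powr 1"
      using nkd(1) by (intro powr_mono) auto
    also have "\<dots> = real n" using nkd(1) by simp
    also have "\<dots> \<le> real (8 * d\<^sup>2)" using False by (simp only: of_nat_le_iff)
    finally have "real n powr (1 / real (Suc h)) \<le> 8 * real d ^ 2" by simp
    then have "1 / 64 * (1 / real d ^ 2) * (1 / real k ^ 3) * real n powr (1 / real (Suc h))
        \<le> 1 / 64 * (1 / real d ^ 2) * 1 * (8 * real d ^ 2)"
      using one_le_power[of "real k" 3] nkd(2) by (intro mult_mono) auto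
    also have "\<dots> \<le> X ! 0" using nkd(3) X(4) by simp
    also have "\<dots> \<le> OPT k X"
      using X(1) nkd(1) unfolding distinct_inputs_def by (intro OPT_ge_first_request[OF nkd(2)]) auto
    finally show ?thesis unfolding exponent using X(1-3) by blast
  qed
qed simp

end
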